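(* For each positive integer $n$ let $p=p(n)$ be a positive integer with $p(n)\le n$, and let $X_1,\dots,X_{n+1}$ be i.i.d. random vectors with distribution $\mathcal{N}_p(\mu,\Sigma)$, where $\mu\in\mathbb{R}^p$ and $\Sigma$ is a $p\times p$ positive definite matrix ($p$, $\mu$, $\Sigma$ may depend on $n$). Let $\hat\Sigma$ be the sample covariance matrix. Then, as $n\to\infty$, $$\frac{\log\det\hat\Sigma-\tau_{n,p}-\log\det\Sigma}{\sigma_{n,p}}\ \longrightarrow\ \mathcal{N}(0,1)\quad\text{in distribution.}$$
   Context: The sample covariance matrix is $\hat\Sigma=\frac1n\sum_{k=1}^{n+1}(X_k-\bar X)(X_k-\bar X)^T$, where $\bar X=\frac{1}{n+1}\sum_{k=1}^{n+1}X_k$. The constants are $$\tau_{n,p}=\sum_{k=1}^p\left[\psi\left(\frac{n-k+1}{2}\right)-\log\left(\frac n2\right)\right],\qquad \sigma_{n,p}=\left(\sum_{k=1}^p\frac{2}{n-k+1}\right)^{1/2},$$ where $\psi(x)=\frac{d}{dx}\log\Gamma(x)$ is the digamma function. The dimension $p$ may be fixed or grow with $n$; no limit of $p(n)/n$ is assumed to exist. *)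

theory Defs
  imports "HOL-Probability.Probability"
    "Jordan_Normal_Form.Determinant"
    "Jordan_Normal_Form.Gauss_Jordan_Elimination"
begin

(* The dimension p varies with the sample size, so points of R^p are functions on the index
   set {..<p} (0-based, extensional, i.e. elements of space (PiM {..<p} _)), while matrices
   are carrier-based.  Names such as vec and det also exist in HOL-Analysis for
   type-indexed dimensions; here they are qualified to select the carrier-based versions. *)

definition positive_definite_mat :: "nat \<Rightarrow> real mat \<Rightarrow> bool" where
  "positive_definite_mat p A \<longleftrightarrow>
     A \<in> carrier_mat p p \<and> transpose_mat A = A \<and>
     (\<forall>v\<in>carrier_vec p. v \<noteq> 0\<^sub>v p \<longrightarrow> 0 < v \<bullet> (A *\<^sub>v v))"

(* Lebesgue density on R^p of N_p(mu, A).  The term the (mat_inverse A) is the inverse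
   matrix, which exists whenever A is positive definite. *)
definition multivariate_normal_density ::
    "nat \<Rightarrow> (nat \<Rightarrow> real) \<Rightarrow> real mat \<Rightarrow> (nat \<Rightarrow> real) \<Rightarrow> real" where
  "multivariate_normal_density p \<mu> A x =
     (let y = Matrix.vec p (\<lambda>i. x i - \<mu> i)
      in exp (- (y \<bullet> (the (mat_inverse A) *\<^sub>v y)) / 2) / sqrt ((2 * pi) ^ p * Determinant.det A))"

definition sample_mean :: "nat \<Rightarrow> (nat \<Rightarrow> 'a \<Rightarrow> nat \<Rightarrow> real) \<Rightarrow> 'a \<Rightarrow> nat \<Rightarrow> real" where
  "sample_mean n X \<omega> i = (\<Sum>k=1..n+1. X k \<omega> i) / real (n + 1)"

(* The outer products (X_k - mean)(X_k - mean)^T are written out entrywise. *)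
definition sample_covariance ::
    "nat \<Rightarrow> nat \<Rightarrow> (nat \<Rightarrow> 'a \<Rightarrow> nat \<Rightarrow> real) \<Rightarrow> 'a \<Rightarrow> real mat" where
  "sample_covariance n p X \<omega> = Matrix.mat p p (\<lambda>(i, j).
     1 / real n * (\<Sum>k=1..n+1.
       (X k \<omega> i - sample_mean n X \<omega> i) * (X k \<omega> j - sample_mean n X \<omega> j)))"

(* Digamma is the derivative of ln_Gamma on the positive reals
   (has_field_derivative_ln_Gamma_real). *)
definition tau_const :: "nat \<Rightarrow> nat \<Rightarrow> real" where
  "tau_const n p = (\<Sum>k=1..p. Digamma ((real n - real k + 1) / 2) - ln (real n / 2))"

definition sigma_const :: "nat \<Rightarrow> nat \<Rightarrow> real" where
  "sigma_const n p = sqrt (\<Sum>k=1..p. 2 / (real n - real k + 1))"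

end

theory Submission
  imports Defs "HOL-Real_Asymp.Real_Asymp"
begin

text \<open>
  Up to a deterministic factor, the determinant of the sample covariance matrix is a product of
  independent chi-square variables with \<open>n, n - 1, \<dots>, n - p + 1\<close> degrees of freedom (Bartlett).
  The characteristic function of the logarithm of such a product is an explicit product of Gamma
  quotients, so the limit law can be read off from a Taylor expansion of \<open>ln_Gamma\<close> and
  Levy's continuity theorem.

  Standardization.  Completing squares in the exponent writes the density of
  \<open>N\<^sub>p(\<mu>, \<Sigma>)\<close> as a product of univariate normal densities, the \<open>i\<close>-th one centred at a
  linear function of the earlier coordinates (\<open>normal_density_regression_factorization\<close>).
  The standardized regression errors of all observations are therefore i.i.d. standard normal, and
  passing to them divides the determinant by \<open>det \<Sigma>\<close>, because the change of coordinates is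
  triangular.  Let \<open>N = n + 1\<close> be the number of observations.  Gram-Schmidt applied to the
  constant vector and the \<open>p\<close> columns of the data in \<open>\<real>\<^sup>N\<close> turns the Gram determinant of the
  centred columns into the product of the squared norms of the residuals
  (\<open>det_sample_covariance\<close>).

  Law of the residuals.  Given the previous columns, the squared norm of the residual of a
  standard Gaussian column is \<open>|x|\<^sup>2 - \<Sum>\<^sub>j \<langle>e\<^sub>j, x\<rangle>\<^sup>2\<close> for an orthonormal family \<open>e\<close>.  Rotation
  invariance would give its law, but no basis has to be completed: writing
  \<open>exp (\<lambda> \<langle>e\<^sub>j, x\<rangle>\<^sup>2)\<close> as a Gaussian average of \<open>exp (sqrt (2 \<lambda>) g\<^sub>j \<langle>e\<^sub>j, x\<rangle>)\<close> and
  exchanging the two integrals yields the Laplace transform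
  \<open>(1 + 2 \<lambda>) powr (- (N - card J) / 2)\<close> (\<open>Laplace_residual_sum_of_squares\<close>).  A law on
  \<open>[0, \<infinity>)\<close> is determined by its Laplace transform at the naturals, since these are the moments of
  the bounded variable \<open>exp (- Q)\<close>; hence the law is the chi-square law, whose characteristic
  function after taking logarithms is a quotient of Gamma values (\<open>chi_square_Mellin\<close>).  As
  this law does not depend on the previous columns, the factors multiply
  (\<open>integral_prod_unit_power_residual_ss\<close>).

  Limit.  With \<open>a\<^sub>i = (n - i) / 2\<close> the characteristic function of the standardized statistic at
  \<open>t\<close> is \<open>\<Prod>\<^sub>i \<Gamma>(a\<^sub>i + \<i> u) / \<Gamma>(a\<^sub>i) * exp (- \<i> u \<psi>(a\<^sub>i))\<close> with \<open>u = t / \<sigma>\<^sub>n\<^sub>,\<^sub>p\<close>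
  (\<open>char_standardized_log_det\<close>).  The second-order Taylor polynomial of the logarithm of the
  \<open>i\<close>-th factor is \<open>- u\<^sup>2 / (2 a\<^sub>i)\<close> up to \<open>(u\<^sup>2 + 3 |u|\<^sup>3) / a\<^sub>i\<^sup>2\<close>
  (\<open>log_Gamma_char_remainder_bound\<close>), and \<open>\<sigma>\<^sup>2 = \<Sum>\<^sub>i 1 / a\<^sub>i\<close>, so the main terms add up to
  \<open>- t\<^sup>2 / 2\<close>.  The errors vanish uniformly in \<open>1 \<le> p \<le> n\<close>: either the smallest \<open>a\<^sub>i\<close> is large,
  which makes every single term negligible, or the harmonic sum \<open>\<sigma>\<^sup>2\<close> is large while
  \<open>\<Sum>\<^sub>i 1 / a\<^sub>i\<^sup>2\<close> stays bounded (\<open>reciprocal_sums_ratio_bounds\<close>).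
\<close>

section \<open>Gaussian integrals of exponentials of quadratic forms\<close>

abbreviation std_gaussian :: "'k set \<Rightarrow> ('k \<Rightarrow> real) measure" where
  "std_gaussian K \<equiv> PiM K (\<lambda>_. std_normal_distribution)"

lemma prob_space_std_normal: "prob_space std_normal_distribution"
  by (rule prob_space_normal_density) simp

lemma prob_space_std_gaussian: "prob_space (std_gaussian K)"
  by (intro prob_space_PiM prob_space_std_normal)

interpretation std_gaussian: product_sigma_finite "\<lambda>_. std_normal_distribution"
  by (intro product_sigma_finite.intro prob_space_imp_sigma_finite prob_space_std_normal)

lemma sets_std_gaussian: "sets (std_gaussian K) = sets (PiM K (\<lambda>_. borel))"
  by (intro sets_PiM_cong) auto

text \<open>
  Completing the square turns the integrand into a multiple of the density of a normal law with
  variance \<open>1 / (1 - 2 * c)\<close>, which has mass one.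
\<close>

lemma nn_integral_std_normal_exp_quadratic:
  fixes b c :: real
  assumes c: "c < 1 / 2"
  shows "(\<integral>\<^sup>+x. ennreal (exp (b * x + c * x^2)) \<partial>std_normal_distribution)
       = ennreal ((1 - 2 * c) powr (- 1 / 2) * exp (b^2 / (2 * (1 - 2 * c))))"
proof -
  define v where "v = 1 - 2 * c"
  have v: "v > 0" using c by (simp add: v_def)
  define C where "C = v powr (- 1 / 2) * exp (b^2 / (2 * v))"
  have C: "C \<ge> 0" by (simp add: C_def)
  have eq: "std_normal_density x * exp (b * x + c * x^2) = C * normal_density (b / v) (1 / sqrt v) x" for x
  proof -
    have "- (x^2) / 2 + (b * x + c * x^2) = b^2 / (2 * v) + - ((x - b / v)^2 / (2 * (1 / sqrt v)^2))"
    proof -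
      have "- (x^2) / 2 + (b * x + c * x^2) = b * x - v * x^2 / 2" by (simp add: v_def field_simps)
      also have "\<dots> = b^2 / (2 * v) - v * (x - b / v)^2 / 2"
        using v by (simp add: field_simps power2_eq_square)
      finally show ?thesis using v by (simp add: power_divide)
    qed
    then have 1: "exp (- (x^2) / 2) * exp (b * x + c * x^2)
       = exp (b^2 / (2 * v)) * exp (- ((x - b / v)^2 / (2 * (1 / sqrt v)^2)))"
      by (simp only: exp_add[symmetric])
    have 2: "v powr (- 1 / 2) * (1 / sqrt (2 * pi * (1 / sqrt v)^2)) = 1 / sqrt (2 * pi)"
      using v by (simp add: powr_minus powr_half_sqrt power_divide real_sqrt_mult real_sqrt_divide)
    have "std_normal_density x * exp (b * x + c * x^2)
        = 1 / sqrt (2 * pi) * (exp (- (x^2) / 2) * exp (b * x + c * x^2))"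
      by (simp add: std_normal_density_def)
    also have "\<dots> = C * normal_density (b / v) (1 / sqrt v) x"
      unfolding 1 2[symmetric] by (simp add: C_def normal_density_def)
    finally show ?thesis .
  qed
  have "(\<integral>\<^sup>+x. ennreal (exp (b * x + c * x^2)) \<partial>std_normal_distribution)
     = (\<integral>\<^sup>+x. ennreal (std_normal_density x) * ennreal (exp (b * x + c * x^2)) \<partial>lborel)"
    by (rule nn_integral_density) auto
  also have "\<dots> = (\<integral>\<^sup>+x. ennreal C * ennreal (normal_density (b / v) (1 / sqrt v) x) \<partial>lborel)"
    using C by (intro nn_integral_cong) (simp add: ennreal_mult'[symmetric] eq)
  also have "\<dots> = ennreal C * (\<integral>\<^sup>+x. ennreal (normal_density (b / v) (1 / sqrt v) x) \<partial>lborel)"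
    by (rule nn_integral_cmult) auto
  also have "(\<integral>\<^sup>+x. ennreal (normal_density (b / v) (1 / sqrt v) x) \<partial>lborel) = 1"
    using v by (subst nn_integral_eq_integral) auto
  finally show ?thesis by (simp add: C_def v_def)
qed

lemma nn_integral_std_gaussian_exp_quadratic:
  fixes b :: "'k \<Rightarrow> real" and c :: real
  assumes K: "finite K" and c: "c < 1 / 2"
  shows "(\<integral>\<^sup>+x. ennreal (exp (\<Sum>k\<in>K. b k * x k + c * (x k)^2)) \<partial>std_gaussian K)
       = ennreal ((1 - 2 * c) powr (- real (card K) / 2) * exp ((\<Sum>k\<in>K. (b k)^2) / (2 * (1 - 2 * c))))"
proof -
  have v: "1 - 2 * c > 0" using c by simp
  have "(\<integral>\<^sup>+x. ennreal (exp (\<Sum>k\<in>K. b k * x k + c * (x k)^2)) \<partial>std_gaussian K)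
     = (\<integral>\<^sup>+x. (\<Prod>k\<in>K. ennreal (exp (b k * x k + c * (x k)^2))) \<partial>std_gaussian K)"
    using K by (simp add: exp_sum prod_ennreal)
  also have "\<dots> = (\<Prod>k\<in>K. \<integral>\<^sup>+y. ennreal (exp (b k * y + c * y^2)) \<partial>std_normal_distribution)"
    by (rule std_gaussian.product_nn_integral_prod[OF K]) measurable
  also have "\<dots> = (\<Prod>k\<in>K. ennreal ((1 - 2 * c) powr (- 1 / 2) * exp ((b k)^2 / (2 * (1 - 2 * c)))))"
    by (simp only: nn_integral_std_normal_exp_quadratic[OF c])
  also have "\<dots> = ennreal (\<Prod>k\<in>K. (1 - 2 * c) powr (- 1 / 2) * exp ((b k)^2 / (2 * (1 - 2 * c))))"
    by (rule prod_ennreal) simp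
  also have "(\<Prod>k\<in>K. (1 - 2 * c) powr (- 1 / 2) * exp ((b k)^2 / (2 * (1 - 2 * c))))
     = ((1 - 2 * c) powr (- 1 / 2)) ^ card K * exp (\<Sum>k\<in>K. (b k)^2 / (2 * (1 - 2 * c)))"
    using K by (simp add: prod.distrib exp_sum)
  also have "((1 - 2 * c) powr (- 1 / 2)) ^ card K = (1 - 2 * c) powr (- real (card K) / 2)"
    using v by (simp add: powr_realpow[symmetric] powr_powr)
  finally show ?thesis by (simp add: sum_divide_distrib)
qed

text \<open>
  The squared distance of a standard Gaussian vector from the span of \<open>e\<close> has the Laplace transform
  of a chi-square variable with \<open>card K - card J\<close> degrees of freedom.  The factor
  \<open>exp (l * \<langle>e\<^sub>j, x\<rangle>\<^sup>2)\<close> is itself a Gaussian integral over an auxiliary variable \<open>g\<^sub>j\<close>, whose exponent is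
  linear in \<open>x\<close>; Tonelli's theorem then reduces everything to integrals of product form, first over
  \<open>x\<close> and then over \<open>g\<close>, where orthonormality makes the remaining exponent a multiple of \<open>|g|\<^sup>2\<close>.
\<close>

lemma Laplace_residual_sum_of_squares:
  fixes e :: "'j \<Rightarrow> 'k \<Rightarrow> real" and l :: real
  assumes K: "finite K" and J: "finite J" and l: "l \<ge> 0"
    and orth: "\<And>i j. i \<in> J \<Longrightarrow> j \<in> J \<Longrightarrow> (\<Sum>k\<in>K. e i k * e j k) = (if i = j then 1 else 0)"
  shows "(\<integral>\<^sup>+x. ennreal (exp (- l * ((\<Sum>k\<in>K. (x k)^2) - (\<Sum>j\<in>J. (\<Sum>k\<in>K. e j k * x k)^2)))) \<partial>std_gaussian K)
       = ennreal ((1 + 2 * l) powr (- (real (card K) - real (card J)) / 2))"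
    (is "?L = _")
proof -
  define y where "y x j = (\<Sum>k\<in>K. e j k * x k)" for x j
  \<comment> \<open>\<open>m\<close> is the coefficient of \<open>|g|\<^sup>2\<close> that remains after integrating out \<open>x\<close>.\<close>
  define m where "m = l / (1 + 2 * l)"
  have m: "m < 1/2" and v: "1 - 2 * m = 1 / (1 + 2 * l)"
    using l by (auto simp: m_def field_simps)
  have ml: "2 * l * S / (2 + 4 * l) = m * S" for S
    using l by (simp add: m_def field_simps)
  have P: "pair_sigma_finite (std_gaussian K) (std_gaussian J)"
    by (intro pair_sigma_finite.intro prob_space_imp_sigma_finite prob_space_std_gaussian)
  have cross: "(\<Sum>j\<in>J. sqrt (2 * l) * y x j * g j) = (\<Sum>k\<in>K. sqrt (2 * l) * (\<Sum>j\<in>J. e j k * g j) * x k)" for x g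
    unfolding y_def sum_distrib_left sum_distrib_right
    by (subst sum.swap) (simp add: mult_ac)
  have norm: "(\<Sum>k\<in>K. (sqrt (2 * l) * (\<Sum>j\<in>J. e j k * g j))^2) = 2 * l * (\<Sum>j\<in>J. (g j)^2)" for g
  proof -
    have "(\<Sum>k\<in>K. (\<Sum>j\<in>J. e j k * g j)^2) = (\<Sum>k\<in>K. \<Sum>i\<in>J. \<Sum>j\<in>J. g i * g j * (e i k * e j k))"
      by (simp add: power2_eq_square sum_product mult_ac)
    also have "\<dots> = (\<Sum>i\<in>J. \<Sum>j\<in>J. g i * g j * (\<Sum>k\<in>K. e i k * e j k))"
      by (subst sum.swap, intro sum.cong refl, subst sum.swap) (simp add: sum_distrib_left)
    also have "\<dots> = (\<Sum>i\<in>J. \<Sum>j\<in>J. if i = j then g i * g j else 0)"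
      by (intro sum.cong refl) (simp add: orth)
    also have "\<dots> = (\<Sum>j\<in>J. (g j)^2)"
      using J by (simp add: power2_eq_square)
    finally show ?thesis
      using l by (simp add: power_mult_distrib sum_distrib_left[symmetric])
  qed
  have "?L = (\<integral>\<^sup>+x. ennreal (exp (- l * (\<Sum>k\<in>K. (x k)^2))) *
       ennreal (exp (\<Sum>j\<in>J. l * (y x j)^2)) \<partial>std_gaussian K)"
    by (intro nn_integral_cong)
      (simp add: ennreal_mult'[symmetric] exp_add[symmetric] y_def sum_distrib_left[symmetric] algebra_simps)
  also have "\<dots> = (\<integral>\<^sup>+x. ennreal (exp (- l * (\<Sum>k\<in>K. (x k)^2))) *
       (\<integral>\<^sup>+g. ennreal (exp (\<Sum>j\<in>J. sqrt (2 * l) * y x j * g j + 0 * (g j)^2)) \<partial>std_gaussian J) \<partial>std_gaussian K)"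
    using l by (subst nn_integral_std_gaussian_exp_quadratic[OF J])
      (simp_all add: power_mult_distrib sum_distrib_left[symmetric])
  also have "\<dots> = (\<integral>\<^sup>+x. \<integral>\<^sup>+g. ennreal (exp (\<Sum>k\<in>K. sqrt (2 * l) * (\<Sum>j\<in>J. e j k * g j) * x k + (-l) * (x k)^2))
       \<partial>std_gaussian J \<partial>std_gaussian K)"
    by (subst nn_integral_cmult[symmetric], measurable)
      (simp add: ennreal_mult'[symmetric] exp_add[symmetric] cross sum.distrib sum_negf sum_subtractf sum_distrib_left add.commute)
  also have "\<dots> = (\<integral>\<^sup>+g. \<integral>\<^sup>+x. ennreal (exp (\<Sum>k\<in>K. sqrt (2 * l) * (\<Sum>j\<in>J. e j k * g j) * x k + (-l) * (x k)^2))
       \<partial>std_gaussian K \<partial>std_gaussian J)"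
    by (rule pair_sigma_finite.Fubini'[OF P, symmetric]) measurable
  also have "\<dots> = (\<integral>\<^sup>+g. ennreal ((1 + 2 * l) powr (- real (card K) / 2)) *
       ennreal (exp (\<Sum>j\<in>J. 0 * g j + m * (g j)^2)) \<partial>std_gaussian J)"
    using l by (subst nn_integral_std_gaussian_exp_quadratic[OF K])
      (simp_all add: norm ml ennreal_mult'[symmetric] sum_distrib_left[symmetric])
  also have "\<dots> = ennreal ((1 + 2 * l) powr (- real (card K) / 2)) *
       (\<integral>\<^sup>+g. ennreal (exp (\<Sum>j\<in>J. 0 * g j + m * (g j)^2)) \<partial>std_gaussian J)"
    by (rule nn_integral_cmult) measurable
  also have "(\<integral>\<^sup>+g. ennreal (exp (\<Sum>j\<in>J. 0 * g j + m * (g j)^2)) \<partial>std_gaussian J)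
      = ennreal ((1 + 2 * l) powr (real (card J) / 2))"
    unfolding nn_integral_std_gaussian_exp_quadratic[OF J m] v
    using l by (simp add: powr_divide powr_minus_divide)
  also have "ennreal ((1 + 2 * l) powr (- real (card K) / 2)) * ennreal ((1 + 2 * l) powr (real (card J) / 2))
      = ennreal ((1 + 2 * l) powr (- (real (card K) - real (card J)) / 2))"
    by (simp add: ennreal_mult'[symmetric] powr_add[symmetric] diff_divide_distrib)
  finally show ?thesis .
qed

section \<open>Gram determinants and Gram-Schmidt residuals\<close>

definition gram_matrix :: "nat \<Rightarrow> 'k set \<Rightarrow> (nat \<Rightarrow> 'k \<Rightarrow> real) \<Rightarrow> real mat" where
  "gram_matrix p K f = Matrix.mat p p (\<lambda>(i, j). \<Sum>k\<in>K. f i k * f j k)"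

text \<open>
  If the \<open>g i\<close> are combinations of the \<open>f j\<close> with a lower triangular coefficient matrix \<open>L\<close>, then the
  Gram matrix of \<open>g\<close> is \<open>L\<close> times that of \<open>f\<close> times the transpose of \<open>L\<close>.
\<close>

lemma det_gram_matrix_triangular:
  assumes g: "\<And>i k. i < p \<Longrightarrow> k \<in> K \<Longrightarrow> g i k = (\<Sum>j\<le>i. b i j * f j k)"
  shows "Determinant.det (gram_matrix p K g) = (\<Prod>i<p. b i i)^2 * Determinant.det (gram_matrix p K f)"
proof -
  define L where "L = Matrix.mat p p (\<lambda>(i, j). if j \<le> i then b i j else 0)"
  have L: "L \<in> carrier_mat p p" by (simp add: L_def)
  have F: "gram_matrix p K f \<in> carrier_mat p p" by (simp add: gram_matrix_def)
  have g': "g i k = (\<Sum>j<p. L $$ (i, j) * f j k)" if "i < p" "k \<in> K" for i k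
  proof -
    have "(\<Sum>j<p. L $$ (i, j) * f j k) = (\<Sum>j\<in>{..i}. L $$ (i, j) * f j k)"
      using that by (intro sum.mono_neutral_right) (auto simp: L_def)
    also have "\<dots> = (\<Sum>j\<le>i. b i j * f j k)"
      using that by (intro sum.cong) (auto simp: L_def)
    finally show ?thesis using g[OF that] by simp
  qed
  have "gram_matrix p K g = L * gram_matrix p K f * transpose_mat L"
  proof (rule eq_matI)
    fix i j assume ij: "i < dim_row (L * gram_matrix p K f * transpose_mat L)"
      "j < dim_col (L * gram_matrix p K f * transpose_mat L)"
    then have i: "i < p" and j: "j < p" using L by auto
    have "(L * gram_matrix p K f * transpose_mat L) $$ (i, j)
        = (\<Sum>c<p. (\<Sum>a<p. L $$ (i, a) * (\<Sum>k\<in>K. f a k * f c k)) * L $$ (j, c))"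
      using i j L F by (simp add: scalar_prod_def gram_matrix_def atLeast0LessThan)
    also have "\<dots> = (\<Sum>c<p. \<Sum>a<p. \<Sum>k\<in>K. (L $$ (i, a) * f a k) * (L $$ (j, c) * f c k))"
      by (simp add: sum_distrib_left sum_distrib_right mult_ac)
    also have "\<dots> = (\<Sum>c<p. \<Sum>k\<in>K. \<Sum>a<p. (L $$ (i, a) * f a k) * (L $$ (j, c) * f c k))"
      by (intro sum.cong refl sum.swap)
    also have "\<dots> = (\<Sum>k\<in>K. \<Sum>c<p. \<Sum>a<p. (L $$ (i, a) * f a k) * (L $$ (j, c) * f c k))"
      by (rule sum.swap)
    also have "\<dots> = (\<Sum>k\<in>K. (\<Sum>a<p. L $$ (i, a) * f a k) * (\<Sum>c<p. L $$ (j, c) * f c k))"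
      unfolding sum_product by (intro sum.cong refl sum.swap)
    also have "\<dots> = gram_matrix p K g $$ (i, j)"
      using i j by (simp add: gram_matrix_def g')
    finally show "gram_matrix p K g $$ (i, j) = (L * gram_matrix p K f * transpose_mat L) $$ (i, j)" ..
  qed (use L in \<open>auto simp: gram_matrix_def\<close>)
  moreover have "Determinant.det L = (\<Prod>i<p. b i i)"
    using det_lower_triangular[of p L] L
    by (simp add: prod_list_diag_prod L_def atLeast0LessThan)
  ultimately show ?thesis
    using L F by (simp add: det_mult[of _ p] det_transpose[of _ p] power2_eq_square)
qed

lemma det_gram_matrix_orthogonal:
  assumes "\<And>i j. i < p \<Longrightarrow> j < p \<Longrightarrow> i \<noteq> j \<Longrightarrow> (\<Sum>k\<in>K. f i k * f j k) = 0"
  shows "Determinant.det (gram_matrix p K f) = (\<Prod>i<p. \<Sum>k\<in>K. (f i k)^2)"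
proof -
  have "Determinant.det (gram_matrix p K f) = prod_list (diag_mat (gram_matrix p K f))"
    by (rule det_lower_triangular[of p]) (auto simp: gram_matrix_def assms)
  then show ?thesis
    by (simp add: prod_list_diag_prod gram_matrix_def atLeast0LessThan power2_eq_square)
qed

text \<open>
  The residual is not normalized.  If an earlier residual vanishes, its coefficient is a division by
  zero and hence \<open>0\<close>, so that orthogonality and the triangular relation between \<open>v\<close> and its residuals
  hold for dependent vectors as well.
\<close>

fun gs_residual :: "'k set \<Rightarrow> (nat \<Rightarrow> 'k \<Rightarrow> real) \<Rightarrow> nat \<Rightarrow> 'k \<Rightarrow> real" where
  "gs_residual K v i = (\<lambda>k. v i k - (\<Sum>j<i.
     (\<Sum>m\<in>K. v i m * gs_residual K v j m) / (\<Sum>m\<in>K. (gs_residual K v j m)^2) * gs_residual K v j k))"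

declare gs_residual.simps [simp del]

lemma gs_residual_0: "gs_residual K v 0 = v 0"
  by (subst gs_residual.simps) simp

lemma gs_residual_cong:
  assumes "\<And>j k. j \<le> i \<Longrightarrow> k \<in> K \<Longrightarrow> v j k = v' j k" and "k \<in> K"
  shows "gs_residual K v i k = gs_residual K v' i k"
  using assms
proof (induction i arbitrary: k rule: less_induct)
  case (less i)
  have IH: "gs_residual K v j m = gs_residual K v' j m" if "j < i" "m \<in> K" for j m
    using that less.prems by (intro less.IH) auto
  show ?case
    unfolding gs_residual.simps[of K _ i] using less.prems IH
    by (intro arg_cong2[where f = minus] arg_cong2[where f = times] arg_cong2[where f = divide] sum.cong) auto
qed

lemma gs_residual_orthogonal:
  assumes K: "finite K" and "i \<noteq> j"
  shows "(\<Sum>k\<in>K. gs_residual K v i k * gs_residual K v j k) = 0"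
proof -
  let ?w = "gs_residual K v"
  have "\<forall>j<i. (\<Sum>k\<in>K. ?w i k * ?w j k) = 0" for i
  proof (induction i rule: less_induct)
    case (less i)
    show ?case
    proof (intro allI impI)
      fix j assume j: "j < i"
      define c where "c m = (\<Sum>k\<in>K. v i k * ?w m k) / (\<Sum>k\<in>K. (?w m k)^2)" for m
      have "(\<Sum>k\<in>K. ?w i k * ?w j k) = (\<Sum>k\<in>K. v i k * ?w j k - (\<Sum>m<i. c m * (?w m k * ?w j k)))"
        unfolding gs_residual.simps[of K v i] c_def[symmetric]
        by (simp add: left_diff_distrib sum_distrib_right mult.assoc)
      also have "\<dots> = (\<Sum>k\<in>K. v i k * ?w j k) - (\<Sum>m<i. c m * (\<Sum>k\<in>K. ?w m k * ?w j k))"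
        unfolding sum_subtractf by (subst sum.swap) (simp add: sum_distrib_left)
      also have "(\<Sum>m<i. c m * (\<Sum>k\<in>K. ?w m k * ?w j k)) = (\<Sum>m<i. if m = j then c j * (\<Sum>k\<in>K. ?w j k * ?w j k) else 0)"
      proof (intro sum.cong refl)
        fix m assume "m \<in> {..<i}"
        then show "c m * (\<Sum>k\<in>K. ?w m k * ?w j k) = (if m = j then c j * (\<Sum>k\<in>K. ?w j k * ?w j k) else 0)"
          (* The induction hypothesis covers the pair in whichever order the two indices are. *)
          using less.IH[of m] less.IH[of j] j by (cases m j rule: linorder_cases) (auto simp: mult.commute)
      qed
      also have "\<dots> = c j * (\<Sum>k\<in>K. (?w j k)^2)" using j by (simp add: power2_eq_square)
      also have "\<dots> = (\<Sum>k\<in>K. v i k * ?w j k)"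
      proof (cases "(\<Sum>k\<in>K. (?w j k)^2) = 0")
        case True
        then have "\<forall>k\<in>K. ?w j k = 0" using K by (subst (asm) sum_nonneg_eq_0_iff) auto
        then show ?thesis using True by simp
      qed (simp add: c_def)
      finally show "(\<Sum>k\<in>K. ?w i k * ?w j k) = 0" by simp
    qed
  qed
  from this[of i] this[of j] show ?thesis
    using \<open>i \<noteq> j\<close> by (cases i j rule: linorder_cases) (auto simp: mult.commute)
qed

text \<open>
  Pythagoras, with the earlier residuals normalized.  A vanishing residual contributes \<open>0\<close> to the sum,
  again by division by zero.
\<close>

lemma gs_residual_sum_of_squares:
  assumes K: "finite K"
  shows "(\<Sum>k\<in>K. (gs_residual K v i k)^2) = (\<Sum>k\<in>K. (v i k)^2) -
     (\<Sum>j<i. (\<Sum>k\<in>K. gs_residual K v j k / sqrt (\<Sum>m\<in>K. (gs_residual K v j m)^2) * v i k)^2)"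
proof -
  let ?w = "gs_residual K v"
  define n where "n j = (\<Sum>m\<in>K. (?w j m)^2)" for j
  define c where "c j = (\<Sum>k\<in>K. v i k * ?w j k)" for j
  have n0: "n j \<ge> 0" for j by (simp add: n_def sum_nonneg)
  have w: "?w i k = v i k - (\<Sum>j<i. c j / n j * ?w j k)" for k
    unfolding gs_residual.simps[of K v i] by (simp add: c_def n_def)
  have "(\<Sum>k\<in>K. (?w i k)^2) = (\<Sum>k\<in>K. ?w i k * v i k) - (\<Sum>k\<in>K. ?w i k * (\<Sum>j<i. c j / n j * ?w j k))"
    unfolding sum_subtractf[symmetric] right_diff_distrib[symmetric] w[symmetric] power2_eq_square ..
  also have "(\<Sum>k\<in>K. ?w i k * (\<Sum>j<i. c j / n j * ?w j k)) = (\<Sum>j<i. c j / n j * (\<Sum>k\<in>K. ?w i k * ?w j k))"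
    unfolding sum_distrib_left by (subst sum.swap) (simp add: mult_ac)
  also have "\<dots> = 0"
    by (intro sum.neutral ballI) (simp add: gs_residual_orthogonal[OF K])
  also have "(\<Sum>k\<in>K. ?w i k * v i k) = (\<Sum>k\<in>K. (v i k)^2) - (\<Sum>k\<in>K. \<Sum>j<i. c j / n j * (?w j k * v i k))"
    unfolding sum_subtractf[symmetric] w
    by (simp add: left_diff_distrib sum_distrib_right power2_eq_square mult.assoc)
  also have "(\<Sum>k\<in>K. \<Sum>j<i. c j / n j * (?w j k * v i k)) = (\<Sum>j<i. c j / n j * (\<Sum>k\<in>K. v i k * ?w j k))"
    by (subst sum.swap) (simp add: sum_distrib_left mult_ac)
  also have "\<dots> = (\<Sum>j<i. c j / n j * c j)" by (simp only: c_def)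
  also have "\<dots> = (\<Sum>j<i. (\<Sum>k\<in>K. ?w j k / sqrt (n j) * v i k)^2)"
  proof (intro sum.cong refl)
    fix j
    have "(\<Sum>k\<in>K. ?w j k / sqrt (n j) * v i k) = c j / sqrt (n j)"
      by (simp add: c_def sum_divide_distrib mult.commute)
    then show "c j / n j * c j = (\<Sum>k\<in>K. ?w j k / sqrt (n j) * v i k)^2"
      using n0[of j] by (simp add: power2_eq_square)
  qed
  finally show ?thesis by (simp add: n_def)
qed

section \<open>Chi-square variables identified by their Laplace transform\<close>

text \<open>
  For a law on \<open>[-1, 1]\<close> the exponential series of the characteristic function may be integrated
  termwise, so the moments determine the characteristic function.
\<close>

lemma real_distribution_eqI_moments:
  assumes "real_distribution M" "real_distribution N"
    and M1: "AE x in M. \<bar>x\<bar> \<le> 1" and N1: "AE x in N. \<bar>x\<bar> \<le> 1"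
    and eq: "\<And>k. (\<integral>x. x ^ k \<partial>M) = (\<integral>x. x ^ k \<partial>N)"
  shows "M = N"
proof -
  have approx: "(\<lambda>n. \<Sum>k\<le>n. ((\<i> * t)^k / fact k) * (\<integral>x. x ^ k \<partial>L)) \<longlonglongrightarrow> char L t"
    if "real_distribution L" "AE x in L. \<bar>x\<bar> \<le> 1" for L t
  proof -
    interpret real_distribution L by fact
    have le: "AE x in L. \<bar>x\<bar> ^ k \<le> 1" for k
      using that(2) by (auto elim!: eventually_mono intro: power_le_one)
    have int: "integrable L (\<lambda>x. x ^ k)" "integrable L (\<lambda>x. \<bar>x\<bar> ^ k)" for k
      using le[of k] by (auto intro!: integrable_const_bound[where B = 1] simp: power_abs)
    have bound: "norm (char L t - (\<Sum>k\<le>n. ((\<i> * t)^k / fact k) * (\<integral>x. x ^ k \<partial>L)))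
        \<le> 2 * (\<bar>t\<bar> ^ n / fact n)" for n
    proof -
      have "(\<integral>x. \<bar>x\<bar> ^ n \<partial>L) \<le> (\<integral>x. 1 \<partial>L)"
        using le[of n] int by (intro integral_mono_AE) auto
      then have "(2 * \<bar>t\<bar> ^ n / fact n) * (\<integral>x. \<bar>x\<bar> ^ n \<partial>L) \<le> (2 * \<bar>t\<bar> ^ n / fact n) * 1"
        using prob_space by (intro mult_left_mono) (auto simp del: space_eq_univ)
      then show ?thesis
        using char_approx1[of n t, OF int(1)] by simp
    qed
    have lim: "(\<lambda>n. 2 * (\<bar>t\<bar> ^ n / fact n)) \<longlonglongrightarrow> 0"
      using tendsto_mult[OF tendsto_const[of 2] summable_LIMSEQ_zero[OF summable_exp[of "\<bar>t\<bar>"]]]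
      by (simp add: divide_inverse mult.commute)
    have "(\<lambda>n. char L t - (\<Sum>k\<le>n. ((\<i> * t)^k / fact k) * (\<integral>x. x ^ k \<partial>L))) \<longlonglongrightarrow> 0"
      by (rule Lim_null_comparison[OF always_eventually lim]) (intro allI bound)
    from tendsto_diff[OF tendsto_const[of "char L t"] this] show ?thesis by simp
  qed
  have "char M = char N"
  proof
    fix t
    show "char M t = char N t"
      using approx[OF assms(1) M1, of t] approx[OF assms(2) N1, of t] unfolding eq
      by (rule LIMSEQ_unique)
  qed
  then show ?thesis by (intro Levy_uniqueness assms)
qed

text \<open>
  The values of the Laplace transform at the naturals are the moments of \<open>exp (- f)\<close>, which takes
  values in \<open>[0, 1]\<close>; and \<open>f\<close> is recovered from \<open>exp (- f)\<close> by a logarithm.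
\<close>

lemma distr_eqI_Laplace:
  fixes f :: "'a \<Rightarrow> real" and g :: "'b \<Rightarrow> real"
  assumes "prob_space A" "prob_space B"
    and f[measurable]: "f \<in> borel_measurable A" and g[measurable]: "g \<in> borel_measurable B"
    and f0: "\<And>x. x \<in> space A \<Longrightarrow> 0 \<le> f x" and g0: "\<And>x. x \<in> space B \<Longrightarrow> 0 \<le> g x"
    and eq: "\<And>k::nat. (\<integral>\<^sup>+x. ennreal (exp (- real k * f x)) \<partial>A) = (\<integral>\<^sup>+x. ennreal (exp (- real k * g x)) \<partial>B)"
  shows "distr A borel f = distr B borel g"
proof -
  interpret A: prob_space A by fact
  interpret B: prob_space B by fact
  let ?F = "\<lambda>x. exp (- f x)" and ?G = "\<lambda>x. exp (- g x)"
  have "distr A borel ?F = distr B borel ?G"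
  proof (rule real_distribution_eqI_moments)
    show "real_distribution (distr A borel ?F)" "real_distribution (distr B borel ?G)"
      by (auto intro!: A.real_distribution_distr B.real_distribution_distr)
    show "AE x in distr A borel ?F. \<bar>x\<bar> \<le> 1" "AE x in distr B borel ?G. \<bar>x\<bar> \<le> 1"
      using f0 g0 by (auto simp: AE_distr_iff)
    fix k :: nat
    have "(\<integral>x. x ^ k \<partial>distr A borel ?F) = (\<integral>x. exp (- real k * f x) \<partial>A)"
      by (subst integral_distr) (auto simp: exp_of_nat_mult[symmetric])
    also have "\<dots> = (\<integral>x. exp (- real k * g x) \<partial>B)"
      using eq[of k] by (subst (1 2) integral_eq_nn_integral) auto
    also have "\<dots> = (\<integral>x. x ^ k \<partial>distr B borel ?G)"
      by (subst integral_distr) (auto simp: exp_of_nat_mult[symmetric])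
    finally show "(\<integral>x. x ^ k \<partial>distr A borel ?F) = (\<integral>x. x ^ k \<partial>distr B borel ?G)" .
  qed
  then have "distr (distr A borel ?F) borel (\<lambda>y. - ln y) = distr (distr B borel ?G) borel (\<lambda>y. - ln y)"
    by simp
  then show ?thesis by (simp add: distr_distr comp_def)
qed

definition gamma_density :: "real \<Rightarrow> real \<Rightarrow> real" where
  "gamma_density a x = indicator {0<..} x * (x powr (a - 1) / exp x) / Gamma a"

lemma gamma_density_nonneg: "a > 0 \<Longrightarrow> 0 \<le> gamma_density a x"
  by (auto simp: gamma_density_def intro!: mult_nonneg_nonneg divide_nonneg_nonneg Gamma_real_nonneg)

lemma gamma_density_measurable [measurable]: "gamma_density a \<in> borel_measurable borel"
  unfolding gamma_density_def[abs_def] by measurable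

lemma nn_integral_gamma_density:
  assumes a: "a > 0"
  shows "(\<integral>\<^sup>+x. ennreal (gamma_density a x) \<partial>lborel) = 1"
proof -
  have "ennreal (Gamma a) = (\<integral>\<^sup>+x. ennreal (indicator {0..} x * x powr (a - 1) / exp x) \<partial>lborel)"
    by (rule Gamma_conv_nn_integral_real[OF a])
  also have "\<dots> = (\<integral>\<^sup>+x. ennreal (Gamma a) * ennreal (gamma_density a x) \<partial>lborel)"
    using a Gamma_real_pos[OF a, THEN less_imp_neq]
    by (intro nn_integral_cong) (auto simp: gamma_density_def indicator_def ennreal_mult'[symmetric])
  also have "\<dots> = ennreal (Gamma a) * (\<integral>\<^sup>+x. ennreal (gamma_density a x) \<partial>lborel)"
    by (simp add: nn_integral_cmult)
  finally show ?thesis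
    using Gamma_real_pos[OF a] by (metis ennreal_mult_cancel_left ennreal_neq_top ennreal_eq_0_iff not_le mult.right_neutral)
qed

lemma nn_integral_gamma_density_exp:
  assumes a: "a > 0" and c: "c \<ge> 0"
  shows "(\<integral>\<^sup>+x. ennreal (gamma_density a x) * ennreal (exp (- c * x)) \<partial>lborel) = ennreal ((1 + c) powr (- a))"
proof -
  have *: "gamma_density a x * exp (- c * x) = (1 + c) powr (1 - a) * gamma_density a (0 + (1 + c) * x)" for x
  proof (cases "x > 0")
    case True
    have "(1 + c) powr (1 - a) * ((1 + c) * x) powr (a - 1) = x powr (a - 1)"
      using True c by (simp add: powr_mult mult.assoc[symmetric] powr_add[symmetric])
    moreover have "exp x / exp (- c * x) = exp ((1 + c) * x)"
      by (simp add: exp_diff[symmetric] algebra_simps)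
    moreover have "(1 + c) * x > 0" using True c by simp
    ultimately show ?thesis
      using True by (simp add: gamma_density_def field_simps)
  next
    case False
    moreover have "\<not> (1 + c) * x > 0" using False c by (simp add: zero_less_mult_iff)
    ultimately show ?thesis by (simp add: gamma_density_def)
  qed
  have "(\<integral>\<^sup>+x. ennreal (gamma_density a x) * ennreal (exp (- c * x)) \<partial>lborel)
      = (\<integral>\<^sup>+x. ennreal ((1 + c) powr (1 - a)) * ennreal (gamma_density a (0 + (1 + c) * x)) \<partial>lborel)"
    using gamma_density_nonneg[OF a] by (intro nn_integral_cong) (simp only: * ennreal_mult'[symmetric] powr_ge_zero exp_ge_zero)
  also have "\<dots> = ennreal ((1 + c) powr (1 - a)) * (\<integral>\<^sup>+x. ennreal (gamma_density a (0 + (1 + c) * x)) \<partial>lborel)"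
    by (rule nn_integral_cmult) measurable
  also have "\<dots> = ennreal ((1 + c) powr (- a)) *
      (ennreal \<bar>1 + c\<bar> * (\<integral>\<^sup>+x. ennreal (gamma_density a (0 + (1 + c) * x)) \<partial>lborel))"
  proof -
    have "(1 + c) powr (1 - a) = (1 + c) powr (- a) * \<bar>1 + c\<bar>"
      using c powr_add[of "1 + c" "- a" 1] by (simp add: algebra_simps)
    then show ?thesis by (simp only: ennreal_mult' mult.assoc powr_ge_zero)
  qed
  also have "ennreal \<bar>1 + c\<bar> * (\<integral>\<^sup>+x. ennreal (gamma_density a (0 + (1 + c) * x)) \<partial>lborel) = 1"
    using c nn_integral_gamma_density[OF a]
    by (subst nn_integral_real_affine[symmetric, of "\<lambda>x. ennreal (gamma_density a x)" "1 + c" 0]) auto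
  finally show ?thesis by simp
qed

text \<open>
  The function \<open>q \<mapsto> q powr (\<i> * s)\<close> on the positive reals.  The value \<open>0\<close> elsewhere makes a product
  vanish as soon as one of its factors degenerates, and for \<open>s = 0\<close> the function is the indicator of
  positivity.
\<close>

definition unit_power :: "real \<Rightarrow> real \<Rightarrow> complex" where
  "unit_power s q = (if q > 0 then iexp (s * ln q) else 0)"

lemma unit_power_measurable [measurable]: "unit_power s \<in> borel_measurable borel"
  unfolding unit_power_def[abs_def] by measurable

lemma norm_unit_power_le: "norm (unit_power s q) \<le> 1"
  by (simp add: unit_power_def)

lemma integral_gamma_density_unit_power:
  assumes a: "a > 0"
  shows "(\<integral>x. gamma_density a x *\<^sub>R unit_power s x \<partial>lborel) = Gamma (Complex a s) / of_real (Gamma a)"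
proof -
  let ?f = "\<lambda>t. complex_of_real t powr (Complex a s - 1) / of_real (exp t)"
  have z: "Re (Complex a s) > 0" using a by simp
  have "(LINT t:{0<..}|lebesgue. ?f t) = integral {0<..} ?f"
    using absolutely_integrable_Gamma_integral'[OF z]
    by (intro set_lebesgue_integral_eq_integral) auto
  also have "\<dots> = Gamma (Complex a s)"
    using Gamma_integral_complex'[OF z] by (rule integral_unique)
  finally have 1: "(LINT t:{0<..}|lebesgue. ?f t) = Gamma (Complex a s)" .
  have eq: "indicator {0<..} t *\<^sub>R ?f t = of_real (Gamma a) * (gamma_density a t *\<^sub>R unit_power s t)" for t
  proof (cases "t > 0")
    case True
    have "complex_of_real t powr (Complex a s - 1) = complex_of_real (t powr (a - 1)) * iexp (s * ln t)"
    proof -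
      have "Complex a s - 1 = of_real (a - 1) + \<i> * s" by (simp add: complex_eq_iff)
      then show ?thesis
        using True by (simp add: powr_def exp_of_real[symmetric] Ln_of_real exp_add[symmetric] algebra_simps)
    qed
    then show ?thesis
      using True Gamma_real_pos[OF a] by (simp add: gamma_density_def unit_power_def scaleR_conv_of_real)
  qed (simp add: gamma_density_def)
  have "Gamma (Complex a s) = (\<integral>t. of_real (Gamma a) * (gamma_density a t *\<^sub>R unit_power s t) \<partial>lebesgue)"
    unfolding 1[symmetric] set_lebesgue_integral_def eq ..
  also have "\<dots> = of_real (Gamma a) * (\<integral>t. gamma_density a t *\<^sub>R unit_power s t \<partial>lebesgue)"
    by (rule integral_mult_right_zero)
  also have "(\<integral>t. gamma_density a t *\<^sub>R unit_power s t \<partial>lebesgue) = (\<integral>t. gamma_density a t *\<^sub>R unit_power s t \<partial>lborel)"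
    by (rule integral_completion) measurable
  finally show ?thesis
    using Gamma_real_pos[OF a] by (simp add: field_simps)
qed

text \<open>
  The variable \<open>Q\<close> has the same Laplace transform as twice a Gamma variable with shape \<open>r / 2\<close>, hence
  the same law, and for the Gamma variable the expectation is Euler's integral at
  \<open>r / 2 + \<i> * s\<close>.
\<close>

lemma chi_square_Mellin:
  fixes Q :: "'a \<Rightarrow> real"
  assumes "prob_space A" and Q[measurable]: "Q \<in> borel_measurable A"
    and Q0: "\<And>x. x \<in> space A \<Longrightarrow> 0 \<le> Q x" and r: "r > 0"
    and Laplace: "\<And>k::nat. (\<integral>\<^sup>+x. ennreal (exp (- real k * Q x)) \<partial>A) = ennreal ((1 + 2 * real k) powr (- r / 2))"
  shows "(\<integral>x. unit_power s (Q x) \<partial>A)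
       = iexp (s * ln 2) * Gamma (Complex (r/2) s) / of_real (Gamma (r/2))"
proof -
  define B where "B = density lborel (\<lambda>x. ennreal (gamma_density (r/2) x))"
  have r2: "r / 2 > 0" using r by simp
  have "prob_space B"
    by (rule prob_spaceI) (simp add: B_def emeasure_density nn_integral_gamma_density[OF r2])
  have B0: "AE x in B. 0 < x"
    unfolding B_def by (subst AE_density) (auto simp: gamma_density_def indicator_def intro!: AE_I2)
  \<comment> \<open>The absolute value changes nothing on the support of \<open>B\<close> and provides nonnegativity everywhere.\<close>
  have "distr A borel Q = distr B borel (\<lambda>x. \<bar>2 * x\<bar>)"
  proof (rule distr_eqI_Laplace)
    fix k :: nat
    have "(\<integral>\<^sup>+x. ennreal (exp (- real k * \<bar>2 * x\<bar>)) \<partial>B) = (\<integral>\<^sup>+x. ennreal (exp (- (2 * real k) * x)) \<partial>B)"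
      using B0 by (intro nn_integral_cong_AE) (elim eventually_mono, simp)
    also have "\<dots> = ennreal ((1 + 2 * real k) powr (- r / 2))"
      unfolding B_def using nn_integral_gamma_density_exp[OF r2, of "2 * real k"]
      by (subst nn_integral_density) auto
    finally show "(\<integral>\<^sup>+x. ennreal (exp (- real k * Q x)) \<partial>A) = (\<integral>\<^sup>+x. ennreal (exp (- real k * \<bar>2 * x\<bar>)) \<partial>B)"
      using Laplace[of k] by simp
  qed (use \<open>prob_space A\<close> \<open>prob_space B\<close> Q0 in \<open>auto simp: B_def\<close>)
  then have "(\<integral>x. unit_power s x \<partial>distr A borel Q) = (\<integral>x. unit_power s x \<partial>distr B borel (\<lambda>x. \<bar>2 * x\<bar>))"
    by simp
  then have "(\<integral>x. unit_power s (Q x) \<partial>A) = (\<integral>x. unit_power s \<bar>2 * x\<bar> \<partial>B)"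
    by (subst (asm) (1 2) integral_distr) (auto simp: B_def)
  also have "\<dots> = (\<integral>x. iexp (s * ln 2) * unit_power s x \<partial>B)"
    using B0 by (intro integral_cong_AE)
      (auto simp: B_def unit_power_def ln_mult distrib_left exp_add[symmetric] elim!: eventually_mono)
  also have "\<dots> = iexp (s * ln 2) * (\<integral>x. unit_power s x \<partial>B)" by simp
  also have "(\<integral>x. unit_power s x \<partial>B) = (\<integral>x. gamma_density (r/2) x *\<^sub>R unit_power s x \<partial>lborel)"
    unfolding B_def using gamma_density_nonneg[OF r2] by (intro integral_density) auto
  finally show ?thesis by (simp add: integral_gamma_density_unit_power[OF r2])
qed

section \<open>The residual sums of squares of a standard Gaussian sample\<close>

text \<open>
  The design of a regression on earlier columns: column \<open>0\<close> is constant, so the first Gram-Schmidt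
  step subtracts the mean, and column \<open>j\<close> of the data \<open>x\<close> becomes column \<open>Suc j\<close>.
\<close>

definition with_intercept :: "(nat \<times> 'k \<Rightarrow> real) \<Rightarrow> nat \<Rightarrow> 'k \<Rightarrow> real" where
  "with_intercept x i = (case i of 0 \<Rightarrow> \<lambda>_. 1 | Suc j \<Rightarrow> \<lambda>k. x (j, k))"

lemma with_intercept_simps [simp]:
  "with_intercept x 0 k = 1" "with_intercept x (Suc j) k = x (j, k)"
  by (simp_all add: with_intercept_def)

definition residual_ss :: "'k set \<Rightarrow> nat \<Rightarrow> (nat \<times> 'k \<Rightarrow> real) \<Rightarrow> real" where
  "residual_ss K i x = (\<Sum>k\<in>K. (gs_residual K (with_intercept x) (Suc i) k)^2)"

lemma residual_ss_nonneg: "0 \<le> residual_ss K i x"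
  by (simp add: residual_ss_def sum_nonneg)

lemma residual_ss_cong:
  assumes "\<And>j k. j \<le> i \<Longrightarrow> k \<in> K \<Longrightarrow> x (j, k) = y (j, k)"
  shows "residual_ss K i x = residual_ss K i y"
proof -
  have "with_intercept x j k = with_intercept y j k" if "j \<le> Suc i" "k \<in> K" for j k
    using that assms by (cases j) auto
  then show ?thesis
    unfolding residual_ss_def by (intro sum.cong refl arg_cong[where f = "\<lambda>t. t ^ 2"] gs_residual_cong) auto
qed

lemma measurable_gs_residual:
  assumes "i \<le> p" and k: "k \<in> K"
  shows "(\<lambda>x. gs_residual K (with_intercept x) i k) \<in> borel_measurable (PiM ({..<p} \<times> K) (\<lambda>_. borel))"
  using assms
proof (induction i arbitrary: k rule: less_induct)
  case (less i)
  have v: "(\<lambda>x. with_intercept x i m) \<in> borel_measurable (PiM ({..<p} \<times> K) (\<lambda>_. borel))" if "m \<in> K" for m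
  proof (cases i)
    case (Suc j)
    then show ?thesis
      using that less.prems by (simp add: measurable_component_singleton)
  qed simp
  have "(\<lambda>x. gs_residual K (with_intercept x) j m) \<in> borel_measurable (PiM ({..<p} \<times> K) (\<lambda>_. borel))"
    if "j < i" "m \<in> K" for j m
    using that less.prems by (intro less.IH) auto
  then show ?case
    unfolding gs_residual.simps[of K _ i] using v less.prems
    by (intro borel_measurable_diff borel_measurable_sum borel_measurable_times borel_measurable_divide
        borel_measurable_power) auto
qed

lemma measurable_residual_ss:
  assumes "i < p"
  shows "residual_ss K i \<in> borel_measurable (PiM ({..<p} \<times> K) (\<lambda>_. borel))"
  unfolding residual_ss_def[abs_def] using assms
  by (intro borel_measurable_sum borel_measurable_power measurable_gs_residual) auto

text \<open>
  The characteristic function at \<open>s\<close> of the logarithm of a chi-square variable with \<open>r\<close> degrees of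
  freedom.
\<close>

definition chi_square_char :: "real \<Rightarrow> real \<Rightarrow> complex" where
  "chi_square_char r s = iexp (s * ln 2) * Gamma (Complex (r / 2) s) / of_real (Gamma (r / 2))"

lemma chi_square_char_0:
  assumes "r > 0"
  shows "chi_square_char r 0 = 1"
proof -
  have "Complex (r / 2) 0 = of_real (r / 2)" by (simp add: complex_of_real_def)
  moreover have "0 < Gamma (r / 2)" by (rule Gamma_real_pos) (use assms in simp)
  ultimately show ?thesis
    unfolding chi_square_char_def by (simp only: Gamma_complex_of_real) simp
qed

text \<open>
  With the earlier columns fixed and nondegenerate, the residual of the last column is taken with
  respect to the \<open>p + 1\<close> orthonormal vectors that come from the constant and those columns.  Its
  squared norm is therefore a chi-square variable with \<open>card K - 1 - p\<close> degrees of freedom, whatever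
  the earlier columns are.
\<close>

lemma integral_last_residual_ss:
  fixes K :: "'k set" and x :: "nat \<times> 'k \<Rightarrow> real"
  assumes K: "finite K" and p: "Suc p < card K" and pos: "\<And>i. i < p \<Longrightarrow> 0 < residual_ss K i x"
  shows "(\<integral>y. unit_power s (residual_ss K p (merge ({..<p} \<times> K) ({p} \<times> K) (x, y))) \<partial>std_gaussian ({p} \<times> K))
       = chi_square_char (real (card K) - 1 - real p) s"
proof -
  let ?mg = "\<lambda>y. merge ({..<p} \<times> K) ({p} \<times> K) (x, y)"
  define w where "w = gs_residual K (with_intercept x)"
  define e where "e j q = w j (snd q) / sqrt (\<Sum>m\<in>K. (w j m)^2)" for j and q :: "nat \<times> 'k"
  have inj: "inj_on (Pair p) K" by (auto simp: inj_on_def)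
  have pK: "{p} \<times> K = Pair p ` K" by auto
  have sum_pK: "(\<Sum>q\<in>{p} \<times> K. f q) = (\<Sum>k\<in>K. f (p, k))" for f :: "nat \<times> 'k \<Rightarrow> real"
    unfolding pK by (simp add: sum.reindex inj comp_def)
  have card_pK: "card ({p} \<times> K) = card K" by (simp add: card_cartesian_product)
  have w: "gs_residual K (with_intercept (?mg y)) j k = w j k" if "j \<le> p" "k \<in> K" for j k y
  proof -
    have "with_intercept (?mg y) i m = with_intercept x i m" if "i \<le> j" "m \<in> K" for i m
      using that \<open>j \<le> p\<close> by (cases i) (auto simp: merge_def)
    then show ?thesis unfolding w_def using that by (intro gs_residual_cong) auto
  qed
  have wpos: "0 < (\<Sum>m\<in>K. (w j m)^2)" if "j \<le> p" for j
  proof (cases j)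
    case 0
    then show ?thesis using p by (simp add: w_def gs_residual_0)
  next
    case (Suc i)
    then show ?thesis using pos[of i] that by (simp add: w_def residual_ss_def)
  qed
  have Q: "residual_ss K p (?mg y) = (\<Sum>q\<in>{p} \<times> K. (y q)^2) - (\<Sum>j\<in>{..p}. (\<Sum>q\<in>{p} \<times> K. e j q * y q)^2)" for y
  proof -
    have y: "?mg y (p, k) = y (p, k)" if "k \<in> K" for k using that by (simp add: merge_def)
    have "residual_ss K p (?mg y) = (\<Sum>k\<in>K. (y (p, k))^2) -
        (\<Sum>j<Suc p. (\<Sum>k\<in>K. gs_residual K (with_intercept (?mg y)) j k /
          sqrt (\<Sum>m\<in>K. (gs_residual K (with_intercept (?mg y)) j m)^2) * y (p, k))^2)"
      unfolding residual_ss_def by (subst gs_residual_sum_of_squares[OF K]) (simp add: y cong: sum.cong)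
    also have "\<dots> = (\<Sum>k\<in>K. (y (p, k))^2) - (\<Sum>j<Suc p. (\<Sum>k\<in>K. w j k / sqrt (\<Sum>m\<in>K. (w j m)^2) * y (p, k))^2)"
      by (intro arg_cong2[where f = minus] sum.cong refl arg_cong[where f = "\<lambda>t. t^2"]
          arg_cong2[where f = times] arg_cong2[where f = divide] arg_cong[where f = sqrt]) (auto simp: w)
    finally show ?thesis
      by (simp add: sum_pK lessThan_Suc_atMost e_def)
  qed
  have orth: "(\<Sum>q\<in>{p} \<times> K. e i q * e j q) = (if i = j then 1 else 0)" if "i \<in> {..p}" "j \<in> {..p}" for i j
  proof -
    define n where "n j = (\<Sum>m\<in>K. (w j m)^2)" for j
    have "(\<Sum>q\<in>{p} \<times> K. e i q * e j q) = (\<Sum>k\<in>K. w i k * w j k) / (sqrt (n i) * sqrt (n j))"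
      by (simp add: sum_pK e_def n_def sum_divide_distrib)
    also have "\<dots> = (if i = j then 1 else 0)"
      using gs_residual_orthogonal[OF K, of i j "with_intercept x", folded w_def] wpos[of i] that
      by (auto simp: n_def[symmetric] power2_eq_square[symmetric])
    finally show ?thesis .
  qed
  show ?thesis
    unfolding chi_square_char_def
  proof (rule chi_square_Mellin[OF prob_space_std_gaussian])
    have "(\<lambda>y. (\<Sum>q\<in>{p} \<times> K. (y q)^2) - (\<Sum>j\<in>{..p}. (\<Sum>q\<in>{p} \<times> K. e j q * y q)^2))
        \<in> borel_measurable (PiM ({p} \<times> K) (\<lambda>_. borel))"
      by measurable
    then show "(\<lambda>y. residual_ss K p (?mg y)) \<in> borel_measurable (std_gaussian ({p} \<times> K))"
      unfolding Q measurable_cong_sets[OF sets_std_gaussian refl] .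
    show "0 < real (card K) - 1 - real p" using p by linarith
    fix k :: nat
    have exponent: "- (real (card ({p} \<times> K)) - real (card {..p})) / 2 = - (real (card K) - 1 - real p) / 2"
      by (simp add: card_pK)
    show "(\<integral>\<^sup>+y. ennreal (exp (- real k * residual_ss K p (?mg y))) \<partial>std_gaussian ({p} \<times> K))
        = ennreal ((1 + 2 * real k) powr (- (real (card K) - 1 - real p) / 2))"
      using Laplace_residual_sum_of_squares[where J = "{..p}" and K = "{p} \<times> K" and e = e and l = "real k", OF _ _ _ orth] K
      unfolding Q exponent by simp
  qed (rule residual_ss_nonneg)
qed

text \<open>
  Integrating out one column at a time: the inner integral is a constant, except where an earlier
  residual vanishes, and there the remaining product is zero by the choice of \<open>unit_power\<close>.  That the
  degenerate configurations are null then follows from the formula itself.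
\<close>

lemma integral_prod_unit_power_residual_ss:
  fixes K :: "'k set"
  assumes K: "finite K" and p: "p < card K"
  shows "(\<integral>x. (\<Prod>i<p. unit_power s (residual_ss K i x)) \<partial>std_gaussian ({..<p} \<times> K))
       = (\<Prod>i<p. chi_square_char (real (card K) - 1 - real i) s)"
  using p
proof (induction p)
  case 0
  show ?case using prob_space.prob_space[OF prob_space_std_gaussian[of "{} :: (nat \<times> 'k) set"]] by simp
next
  case (Suc p)
  let ?I = "{..<p} \<times> K" and ?J = "{p} \<times> K"
  let ?\<kappa> = "\<lambda>i. chi_square_char (real (card K) - 1 - real i) s"
  have IJ: "{..<Suc p} \<times> K = ?I \<union> ?J" by (auto simp: less_Suc_eq)
  have meas: "(\<lambda>x. \<Prod>i<n. unit_power s (residual_ss K i x)) \<in> borel_measurable (std_gaussian ({..<n} \<times> K))" for n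
    unfolding measurable_cong_sets[OF sets_std_gaussian refl]
    by (intro borel_measurable_prod measurable_compose[OF measurable_residual_ss unit_power_measurable]) auto
  have int: "integrable (std_gaussian ({..<n} \<times> K)) (\<lambda>x. \<Prod>i<n. unit_power s (residual_ss K i x))" for n
    by (intro finite_measure.integrable_const_bound[where B = 1] prob_space.finite_measure
        prob_space_std_gaussian meas AE_I2) (auto simp: prod_norm[symmetric] intro!: prod_le_1 norm_unit_power_le)
  have "(\<integral>x. (\<Prod>i<Suc p. unit_power s (residual_ss K i x)) \<partial>std_gaussian ({..<Suc p} \<times> K))
      = (\<integral>x. \<integral>y. (\<Prod>i<Suc p. unit_power s (residual_ss K i (merge ?I ?J (x, y)))) \<partial>std_gaussian ?J \<partial>std_gaussian ?I)"
    using K int[of "Suc p"] unfolding IJ by (intro std_gaussian.product_integral_fold) auto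
  also have "\<dots> = (\<integral>x. (\<Prod>i<p. unit_power s (residual_ss K i x)) * ?\<kappa> p \<partial>std_gaussian ?I)"
  proof (intro Bochner_Integration.integral_cong refl)
    fix x :: "nat \<times> 'k \<Rightarrow> real"
    have R: "residual_ss K i (merge ?I ?J (x, y)) = residual_ss K i x" if "i < p" for i y
      using that by (intro residual_ss_cong) (auto simp: merge_def)
    have "(\<integral>y. (\<Prod>i<Suc p. unit_power s (residual_ss K i (merge ?I ?J (x, y)))) \<partial>std_gaussian ?J)
        = (\<Prod>i<p. unit_power s (residual_ss K i x)) *
          (\<integral>y. unit_power s (residual_ss K p (merge ?I ?J (x, y))) \<partial>std_gaussian ?J)"
      by (simp add: R)
    also have "\<dots> = (\<Prod>i<p. unit_power s (residual_ss K i x)) * ?\<kappa> p"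
    proof (cases "\<forall>i<p. 0 < residual_ss K i x")
      case True
      then show ?thesis using integral_last_residual_ss[OF K Suc.prems, of x s] by simp
    next
      case False
      then have "(\<Prod>i<p. unit_power s (residual_ss K i x)) = 0"
        by (auto simp: prod_zero_iff unit_power_def)
      then show ?thesis by simp
    qed
    finally show "(\<integral>y. (\<Prod>i<Suc p. unit_power s (residual_ss K i (merge ?I ?J (x, y)))) \<partial>std_gaussian ?J)
        = (\<Prod>i<p. unit_power s (residual_ss K i x)) * ?\<kappa> p" .
  qed
  also have "\<dots> = (\<integral>x. (\<Prod>i<p. unit_power s (residual_ss K i x)) \<partial>std_gaussian ?I) * ?\<kappa> p"
    by (rule integral_mult_left_zero)
  finally show ?case using Suc by simp
qed

text \<open>
  The case \<open>s = 0\<close> of the product formula: its left-hand side is the probability that all residuals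
  are nonzero, and its right-hand side is \<open>1\<close>.
\<close>

lemma AE_residual_ss_pos:
  fixes K :: "'k set"
  assumes K: "finite K" and p: "p < card K"
  shows "AE x in std_gaussian ({..<p} \<times> K). \<forall>i<p. 0 < residual_ss K i x"
proof -
  let ?G = "std_gaussian ({..<p} \<times> K)"
  note G = prob_space_std_gaussian[of "{..<p} \<times> K"]
  let ?S = "{x \<in> space ?G. \<forall>i\<in>{..<p}. 0 < residual_ss K i x}"
  have R: "residual_ss K i \<in> borel_measurable ?G" if "i < p" for i
    unfolding measurable_cong_sets[OF sets_std_gaussian refl] using that by (rule measurable_residual_ss)
  have R': "{x \<in> space ?G. 0 < residual_ss K i x} \<in> sets ?G" if "i < p" for i
    using R[OF that] by measurable
  have S: "?S \<in> sets ?G"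
    using R' by (intro sets.sets_Collect_finite_All) auto
  have "complex_of_real (measure ?G ?S) = (\<integral>x. of_real (indicator ?S x) \<partial>?G)"
    using S by simp
  also have "\<dots> = (\<integral>x. (\<Prod>i<p. unit_power 0 (residual_ss K i x)) \<partial>?G)"
    by (intro Bochner_Integration.integral_cong refl)
      (auto simp: indicator_def unit_power_def prod_zero_iff intro!: prod.neutral[symmetric])
  also have "\<dots> = 1"
    unfolding integral_prod_unit_power_residual_ss[OF K p]
    using p by (intro prod.neutral ballI chi_square_char_0) auto
  finally have "measure ?G ?S = 1" by simp
  then show ?thesis using S by (subst (asm) prob_space.prob_Collect_eq_1[OF G]) auto
qed

lemma integral_iexp_ln_residual_ss:
  fixes K :: "'k set"
  assumes K: "finite K" and p: "p < card K"
  shows "(\<integral>x. iexp (s * ln (\<Prod>i<p. residual_ss K i x)) \<partial>std_gaussian ({..<p} \<times> K))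
       = (\<Prod>i<p. chi_square_char (real (card K) - 1 - real i) s)"
proof -
  have meas: "residual_ss K i \<in> borel_measurable (std_gaussian ({..<p} \<times> K))" if "i < p" for i
    unfolding measurable_cong_sets[OF sets_std_gaussian refl] using that by (rule measurable_residual_ss)
  have "(\<integral>x. iexp (s * ln (\<Prod>i<p. residual_ss K i x)) \<partial>std_gaussian ({..<p} \<times> K))
      = (\<integral>x. (\<Prod>i<p. unit_power s (residual_ss K i x)) \<partial>std_gaussian ({..<p} \<times> K))"
  proof (rule integral_cong_AE)
    have "(\<lambda>x. \<Prod>i<p. residual_ss K i x) \<in> borel_measurable (std_gaussian ({..<p} \<times> K))"
      using meas by (intro borel_measurable_prod) auto
    then show "(\<lambda>x. iexp (s * ln (\<Prod>i<p. residual_ss K i x))) \<in> borel_measurable (std_gaussian ({..<p} \<times> K))"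
      by measurable
    show "(\<lambda>x. \<Prod>i<p. unit_power s (residual_ss K i x)) \<in> borel_measurable (std_gaussian ({..<p} \<times> K))"
      using meas by (intro borel_measurable_prod measurable_compose[OF _ unit_power_measurable]) auto
    show "AE x in std_gaussian ({..<p} \<times> K). iexp (s * ln (\<Prod>i<p. residual_ss K i x))
        = (\<Prod>i<p. unit_power s (residual_ss K i x))"
      using AE_residual_ss_pos[OF assms]
    proof eventually_elim
      case (elim x)
      then have "ln (\<Prod>i<p. residual_ss K i x) = (\<Sum>i<p. ln (residual_ss K i x))"
        by (intro ln_prod) auto
      then show ?case
        using elim by (simp add: unit_power_def exp_sum[symmetric] sum_distrib_left)
    qed
  qed
  then show ?thesis by (simp add: integral_prod_unit_power_residual_ss[OF assms])
qed

section \<open>Sequential regression of a multivariate normal vector\<close>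

text \<open>
  An LDL decomposition, stated for the quadratic form rather than for matrices: completing the square
  in the last variable leaves the Schur complement \<open>B'\<close> on the others.  It is again positive definite,
  because its value at \<open>y\<close> is the value of the original form once the last coordinate is chosen to make
  the completed square vanish.
\<close>

lemma positive_definite_complete_squares:
  fixes B :: "nat \<Rightarrow> nat \<Rightarrow> real"
  assumes "\<And>y. \<exists>i<p. y i \<noteq> 0 \<Longrightarrow> 0 < (\<Sum>i<p. \<Sum>j<p. B i j * y i * y j)"
  shows "\<exists>l e. (\<forall>i<p. 0 < e i) \<and>
    (\<forall>y. (\<Sum>i<p. \<Sum>j<p. B i j * y i * y j) = (\<Sum>i<p. e i * (y i - (\<Sum>j<i. l i j * y j))^2))"
  using assms
proof (induction p arbitrary: B)
  case 0
  show ?case by (intro exI[of _ "\<lambda>_. 1"] exI[of _ "\<lambda>_ _. 0"]) simp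
next
  case (Suc p)
  define Q where "Q n B y = (\<Sum>i<n. \<Sum>j<n. B i j * y i * y j)" for n and B :: "nat \<Rightarrow> nat \<Rightarrow> real" and y
  define b where "b = B p p"
  define g where "g j = (B p j + B j p) / 2" for j
  define G where "G y = (\<Sum>j<p. g j * y j)" for y
  define B' where "B' i j = B i j - g i * g j / b" for i j
  have split: "Q (Suc p) B y = Q p B y + 2 * y p * G y + b * (y p)^2" for y
  proof -
    have "2 * y p * G y = (\<Sum>j<p. B p j * y p * y j) + (\<Sum>i<p. B i p * y i * y p)"
      unfolding G_def g_def sum_distrib_left sum.distrib[symmetric]
      by (intro sum.cong refl) (simp add: field_simps)
    then show ?thesis
      by (simp add: Q_def b_def sum.distrib power2_eq_square)
  qed
  have pos: "0 < Q (Suc p) B y" if "\<exists>i<Suc p. y i \<noteq> 0" for y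
    using Suc.prems[OF that] by (simp add: Q_def)
  have b: "b > 0"
    using pos[of "\<lambda>i. if i = p then 1 else 0"] unfolding split by (simp add: Q_def G_def)
  have B': "Q p B' y = Q p B y - (G y)^2 / b" for y
  proof -
    have "(G y)^2 / b = (\<Sum>i<p. \<Sum>j<p. g i * g j / b * y i * y j)"
      unfolding G_def power2_eq_square sum_product sum_divide_distrib
      by (intro sum.cong refl) (simp add: field_simps)
    then show ?thesis
      by (simp add: Q_def B'_def sum_subtractf[symmetric] left_diff_distrib)
  qed
  have pos': "0 < Q p B' y" if y: "\<exists>i<p. y i \<noteq> 0" for y
  proof -
    define z where "z = y(p := - G y / b)"
    have "Q p B z = Q p B y" "G z = G y" by (auto simp: Q_def G_def z_def)
    moreover have "2 * (- a / b) * a + b * (- a / b)^2 = - (a^2 / b)" for a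
      using b by (simp add: field_simps power2_eq_square)
    ultimately have "Q (Suc p) B z = Q p B' y"
      unfolding split B' by (simp add: z_def add.assoc)
    moreover have "\<exists>i<Suc p. z i \<noteq> 0"
      using y by (metis fun_upd_apply less_SucI nat_neq_iff z_def)
    ultimately show ?thesis using pos by metis
  qed
  have "\<exists>l e. (\<forall>i<p. 0 < e i) \<and> (\<forall>y. Q p B' y = (\<Sum>i<p. e i * (y i - (\<Sum>j<i. l i j * y j))^2))"
    unfolding Q_def by (rule Suc.IH, fold Q_def) (rule pos')
  then obtain l e where e: "\<And>i. i < p \<Longrightarrow> 0 < e i"
    and l: "\<And>y. Q p B' y = (\<Sum>i<p. e i * (y i - (\<Sum>j<i. l i j * y j))^2)"
    by blast
  define l' where "l' i j = (if i = p then - g j / b else l i j)" for i j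
  define e' where "e' = e(p := b)"
  have "Q (Suc p) B y = (\<Sum>i<Suc p. e' i * (y i - (\<Sum>j<i. l' i j * y j))^2)" for y
  proof -
    have "(\<Sum>j<p. l' p j * y j) = - G y / b"
      by (simp add: l'_def G_def sum_divide_distrib sum_negf)
    then have "(\<Sum>i<Suc p. e' i * (y i - (\<Sum>j<i. l' i j * y j))^2) = Q p B' y + b * (y p + G y / b)^2"
      by (simp add: l e'_def l'_def)
    also have "\<dots> = Q (Suc p) B y"
      unfolding split B' using b by (simp add: field_simps power2_eq_square)
    finally show ?thesis ..
  qed
  moreover have "\<forall>i<Suc p. 0 < e' i" using e b by (auto simp: e'_def less_Suc_eq)
  ultimately show ?case unfolding Q_def by blast
qed

text \<open>
  With \<open>v\<close> the image of \<open>y\<close> under the inverse, the form of the inverse at \<open>y\<close> is the form of \<open>A\<close> at \<open>v\<close>.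
\<close>

lemma quadratic_form_inverse_pos:
  assumes A: "positive_definite_mat p A" and B: "mat_inverse A = Some B"
    and y: "\<exists>i<p. y i \<noteq> 0"
  shows "0 < Matrix.vec p y \<bullet> (B *\<^sub>v Matrix.vec p y)"
proof -
  have Ac: "A \<in> carrier_mat p p" using A by (simp add: positive_definite_mat_def)
  then have inv: "A * B = 1\<^sub>m p" "B * A = 1\<^sub>m p" and Bc: "B \<in> carrier_mat p p"
    using mat_inverse(2)[OF Ac B] by auto
  let ?y = "Matrix.vec p y"
  define v where "v = B *\<^sub>v ?y"
  have v: "v \<in> carrier_vec p" using Bc by (simp add: v_def)
  have Av: "A *\<^sub>v v = ?y"
    unfolding v_def using Ac Bc inv by (simp add: assoc_mult_mat_vec[symmetric, of _ p p _ p])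
  have "v \<noteq> 0\<^sub>v p"
  proof
    assume "v = 0\<^sub>v p"
    moreover have "A *\<^sub>v 0\<^sub>v p = 0\<^sub>v p" using Ac by (intro eq_vecI) (auto simp: scalar_prod_def)
    ultimately have "?y = 0\<^sub>v p" using Av by simp
    then show False using y by (metis index_vec index_zero_vec(1))
  qed
  then have "0 < v \<bullet> (A *\<^sub>v v)" using A v by (simp add: positive_definite_mat_def)
  also have "v \<bullet> (A *\<^sub>v v) = ?y \<bullet> v" unfolding Av using v by (intro comm_scalar_prod) auto
  finally show ?thesis by (simp add: v_def)
qed

lemma quadratic_form_eq_sum:
  fixes B :: "real mat"
  assumes "B \<in> carrier_mat p p"
  shows "Matrix.vec p y \<bullet> (B *\<^sub>v Matrix.vec p y) = (\<Sum>i<p. \<Sum>j<p. B $$ (i, j) * y i * y j)"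
  using assms
  by (auto simp: scalar_prod_def sum_distrib_left atLeast0LessThan mult.assoc intro!: sum.cong mult.left_commute)

lemma positive_definite_mat_carrier: "positive_definite_mat p A \<Longrightarrow> A \<in> carrier_mat p p"
  by (simp add: positive_definite_mat_def)

text \<open>
  The conditional mean of coordinate \<open>i\<close> given the coordinates before it, for regression
  coefficients \<open>l\<close>.
\<close>

definition regression_mean :: "(nat \<Rightarrow> real) \<Rightarrow> (nat \<Rightarrow> nat \<Rightarrow> real) \<Rightarrow> nat \<Rightarrow> (nat \<Rightarrow> real) \<Rightarrow> real" where
  "regression_mean \<mu> l i x = \<mu> i + (\<Sum>j<i. l i j * (x j - \<mu> j))"

lemma measurable_regression_mean:
  assumes "i \<le> p"
  shows "regression_mean \<mu> l i \<in> borel_measurable (PiM {..<p} (\<lambda>_. borel))"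
  unfolding regression_mean_def[abs_def] using assms
  by (intro borel_measurable_add borel_measurable_const borel_measurable_sum borel_measurable_times
      borel_measurable_diff measurable_component_singleton) auto

lemma nn_integral_normal_density_standardize:
  assumes h[measurable]: "h \<in> borel_measurable borel" and s: "s > 0"
  shows "(\<integral>\<^sup>+y. ennreal (normal_density m s y) * h ((y - m) / s) \<partial>lborel) = (\<integral>\<^sup>+z. h z \<partial>std_normal_distribution)"
proof -
  have eq: "s * normal_density m s (m + s * z) = std_normal_density z" for z
    using s by (simp add: normal_density_def real_sqrt_mult power_mult_distrib field_simps)
  have "(\<integral>\<^sup>+y. ennreal (normal_density m s y) * h ((y - m) / s) \<partial>lborel)
      = ennreal \<bar>s\<bar> * (\<integral>\<^sup>+z. ennreal (normal_density m s (m + s * z)) * h ((m + s * z - m) / s) \<partial>lborel)"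
    using s by (intro nn_integral_real_affine) auto
  also have "\<dots> = (\<integral>\<^sup>+z. ennreal \<bar>s\<bar> * (ennreal (normal_density m s (m + s * z)) * h ((m + s * z - m) / s)) \<partial>lborel)"
    by (rule nn_integral_cmult[symmetric]) measurable
  also have "\<dots> = (\<integral>\<^sup>+z. ennreal (std_normal_density z) * h z \<partial>lborel)"
    using s by (intro nn_integral_cong) (simp add: mult.assoc[symmetric] ennreal_mult'[symmetric] eq)
  also have "\<dots> = (\<integral>\<^sup>+z. h z \<partial>std_normal_distribution)"
    by (rule nn_integral_density[symmetric]) auto
  finally show ?thesis .
qed

text \<open>
  In a product of conditional normal densities the standardized errors are independent and standard
  normal: only the last factor involves the last coordinate, and for fixed earlier coordinates an
  affine substitution turns it into a standard normal integral.  The case \<open>h = (\<lambda>_ _. 1)\<close> says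
  that such a product is a probability density.
\<close>

lemma nn_integral_triangular_normal:
  assumes s: "\<And>i. i < p \<Longrightarrow> s i > 0" and h[measurable]: "\<And>i. h i \<in> borel_measurable borel"
  shows "(\<integral>\<^sup>+x. (\<Prod>i<p. ennreal (normal_density (regression_mean \<mu> l i x) (s i) (x i)) *
            h i ((x i - regression_mean \<mu> l i x) / s i)) \<partial>PiM {..<p} (\<lambda>_. lborel))
       = (\<Prod>i<p. \<integral>\<^sup>+z. h i z \<partial>std_normal_distribution)"
  using s
proof (induction p)
  case 0
  show ?case by (simp add: PiM_empty emeasure_count_space)
next
  case (Suc p)
  interpret product_sigma_finite "\<lambda>_::nat. lborel :: real measure" by standard
  let ?m = "regression_mean \<mu> l"
  let ?F = "\<lambda>i x. ennreal (normal_density (?m i x) (s i) (x i)) * h i ((x i - ?m i x) / s i)"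
  have meas: "?F i \<in> borel_measurable (PiM {..<n} (\<lambda>_. lborel))" if "i < n" for i n
  proof -
    have sets: "sets (PiM {..<n} (\<lambda>_. lborel)) = sets (PiM {..<n} (\<lambda>_. borel :: real measure))"
      by (intro sets_PiM_cong) auto
    have [measurable]: "?m i \<in> borel_measurable (PiM {..<n} (\<lambda>_. borel))"
      "(\<lambda>x. x i) \<in> borel_measurable (PiM {..<n} (\<lambda>_. borel))"
      using that by (auto intro: measurable_regression_mean)
    show ?thesis
      unfolding measurable_cong_sets[OF sets refl] normal_density_def by measurable
  qed
  have m: "?m i (x(p := y)) = ?m i x" if "i \<le> p" for i x y
    using that by (simp add: regression_mean_def)
  have "(\<integral>\<^sup>+x. (\<Prod>i<Suc p. ?F i x) \<partial>PiM {..<Suc p} (\<lambda>_. lborel))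
      = (\<integral>\<^sup>+x. \<integral>\<^sup>+y. (\<Prod>i<Suc p. ?F i (x(p := y))) \<partial>lborel \<partial>PiM {..<p} (\<lambda>_. lborel))"
  proof (rule product_nn_integral_insert[of "{..<p}" p, folded lessThan_Suc])
    show "(\<lambda>x. \<Prod>i<Suc p. ?F i x) \<in> borel_measurable (PiM {..<Suc p} (\<lambda>_. lborel))"
      by (intro borel_measurable_prod_ennreal meas) simp
  qed auto
  also have "\<dots> = (\<integral>\<^sup>+x. (\<Prod>i<p. ?F i x) * (\<integral>\<^sup>+z. h p z \<partial>std_normal_distribution) \<partial>PiM {..<p} (\<lambda>_. lborel))"
  proof (intro nn_integral_cong)
    fix x :: "nat \<Rightarrow> real"
    have "(\<integral>\<^sup>+y. (\<Prod>i<Suc p. ?F i (x(p := y))) \<partial>lborel)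
        = (\<integral>\<^sup>+y. (\<Prod>i<p. ?F i x) * (ennreal (normal_density (?m p x) (s p) y) * h p ((y - ?m p x) / s p)) \<partial>lborel)"
      by (intro nn_integral_cong) (simp add: m)
    also have "\<dots> = (\<Prod>i<p. ?F i x) * (\<integral>\<^sup>+y. ennreal (normal_density (?m p x) (s p) y) * h p ((y - ?m p x) / s p) \<partial>lborel)"
      by (rule nn_integral_cmult) measurable
    finally show "(\<integral>\<^sup>+y. (\<Prod>i<Suc p. ?F i (x(p := y))) \<partial>lborel)
        = (\<Prod>i<p. ?F i x) * (\<integral>\<^sup>+z. h p z \<partial>std_normal_distribution)"
      using Suc.prems by (simp add: nn_integral_normal_density_standardize)
  qed
  also have "\<dots> = (\<integral>\<^sup>+x. (\<Prod>i<p. ?F i x) \<partial>PiM {..<p} (\<lambda>_. lborel)) * (\<integral>\<^sup>+z. h p z \<partial>std_normal_distribution)"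
    by (rule nn_integral_multc) (intro borel_measurable_prod_ennreal meas, simp)
  finally show ?case using Suc by simp
qed

text \<open>
  Completing the squares in the exponent shows that the density and the product of conditional
  densities agree up to a constant factor.  Both have total mass \<open>1\<close>, so the factor is \<open>1\<close>; comparing
  the normalizing constants then yields the determinant, with no determinant computed.  The hypothesis
  on the mass also excludes \<open>det A \<le> 0\<close>, for then the density would nowhere be positive, and so it
  provides the inverse of \<open>A\<close>.
\<close>

lemma normal_density_regression_factorization:
  assumes A: "positive_definite_mat p A"
    and total: "(\<integral>\<^sup>+x. ennreal (multivariate_normal_density p \<mu> A x) \<partial>PiM {..<p} (\<lambda>_. lborel)) = 1"
  obtains l s where "\<And>i. i < p \<Longrightarrow> 0 < s i" "Determinant.det A = (\<Prod>i<p. (s i)^2)"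
    "\<And>x. multivariate_normal_density p \<mu> A x = (\<Prod>i<p. normal_density (regression_mean \<mu> l i x) (s i) (x i))"
proof -
  have Ac: "A \<in> carrier_mat p p" using A by (rule positive_definite_mat_carrier)
  define c where "c = sqrt ((2 * pi) ^ p * Determinant.det A)"
  have c: "c > 0"
  proof (rule ccontr)
    assume "\<not> c > 0"
    moreover have "\<exists>q. multivariate_normal_density p \<mu> A x = exp q / c" for x
      unfolding multivariate_normal_density_def Let_def c_def by blast
    ultimately have "multivariate_normal_density p \<mu> A x \<le> 0" for x
      by (metis divide_nonneg_nonpos exp_ge_zero not_less)
    then have "ennreal (multivariate_normal_density p \<mu> A x) = 0" for x
      by (rule ennreal_neg)
    then show False using total by simp
  qed
  then have "0 < (2 * pi) ^ p * Determinant.det A" by (simp add: c_def)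
  then have "Determinant.det A > 0" by (rule zero_less_mult_pos) simp
  then have "A \<in> Units (ring_mat TYPE(real) p ())"
    using det_non_zero_imp_unit[OF Ac] by simp
  then obtain B where B: "mat_inverse A = Some B"
    using mat_inverse(1)[OF Ac, of "()"] by (cases "mat_inverse A") auto
  have Bc: "B \<in> carrier_mat p p" using mat_inverse(2)[OF Ac B] by simp
  obtain l e where e: "\<And>i. i < p \<Longrightarrow> 0 < e i"
    and l: "\<And>y. (\<Sum>i<p. \<Sum>j<p. B $$ (i, j) * y i * y j) = (\<Sum>i<p. e i * (y i - (\<Sum>j<i. l i j * y j))^2)"
    using positive_definite_complete_squares[of p "\<lambda>i j. B $$ (i, j)"]
      quadratic_form_inverse_pos[OF A B] unfolding quadratic_form_eq_sum[OF Bc] by blast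
  define s where "s i = 1 / sqrt (e i)" for i
  have s: "0 < s i" if "i < p" for i using e[OF that] by (simp add: s_def)
  have es: "e i = 1 / (s i)^2" if "i < p" for i using e[OF that] by (simp add: s_def power_divide)
  let ?q = "\<lambda>x. \<Sum>i<p. (x i - regression_mean \<mu> l i x)^2 / (2 * (s i)^2)"
  define d where "d = (\<Prod>i<p. sqrt (2 * pi * (s i)^2))"
  have d: "d > 0" unfolding d_def
    by (intro prod_pos real_sqrt_gt_zero mult_pos_pos zero_less_power ballI s) auto
  have density: "multivariate_normal_density p \<mu> A x = exp (- ?q x) / c" for x
  proof -
    have "Matrix.vec p (\<lambda>i. x i - \<mu> i) \<bullet> (B *\<^sub>v Matrix.vec p (\<lambda>i. x i - \<mu> i)) / 2
        = (\<Sum>i<p. e i * (x i - regression_mean \<mu> l i x)^2) / 2"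
      unfolding quadratic_form_eq_sum[OF Bc] l by (simp add: regression_mean_def diff_diff_add)
    also have "\<dots> = ?q x"
      unfolding sum_divide_distrib by (intro sum.cong) (simp_all add: es)
    finally show ?thesis
      by (simp add: multivariate_normal_density_def Let_def B c_def)
  qed
  have product: "(\<Prod>i<p. normal_density (regression_mean \<mu> l i x) (s i) (x i)) = exp (- ?q x) / d" for x
    by (simp add: normal_density_def d_def prod.distrib prod_dividef exp_sum sum_negf[symmetric])
  have "1 = (\<integral>\<^sup>+x. (\<Prod>i<p. ennreal (normal_density (regression_mean \<mu> l i x) (s i) (x i))) \<partial>PiM {..<p} (\<lambda>_. lborel))"
    using nn_integral_triangular_normal[of p s "\<lambda>_ _. 1" \<mu> l] s
      prob_space.emeasure_space_1[OF prob_space_std_normal] by simp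
  also have "\<dots> = (\<integral>\<^sup>+x. ennreal (c / d) * ennreal (multivariate_normal_density p \<mu> A x) \<partial>PiM {..<p} (\<lambda>_. lborel))"
    using c d by (intro nn_integral_cong)
      (simp add: prod_ennreal product density ennreal_mult'[symmetric])
  also have "\<dots> = ennreal (c / d) * 1"
  proof -
    have "(\<lambda>x. ennreal (multivariate_normal_density p \<mu> A x)) \<in> borel_measurable (PiM {..<p} (\<lambda>_. lborel))"
    proof -
      have sets: "sets (PiM {..<p} (\<lambda>_. lborel)) = sets (PiM {..<p} (\<lambda>_. borel :: real measure))"
        by (intro sets_PiM_cong) auto
      show ?thesis
        unfolding measurable_cong_sets[OF sets refl] density
        by (intro measurable_compose[OF _ measurable_ennreal] borel_measurable_divide measurable_compose[OF _ borel_measurable_exp]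
          borel_measurable_uminus borel_measurable_sum borel_measurable_power borel_measurable_diff
          borel_measurable_const measurable_regression_mean measurable_component_singleton) auto
    qed
    then show ?thesis unfolding total[symmetric] by (rule nn_integral_cmult)
  qed
  finally have "c = d" using c d by (simp add: ennreal_eq_1)
  have "(2 * pi) ^ p * Determinant.det A = c^2"
    using c by (simp add: c_def)
  also have "\<dots> = (2 * pi) ^ p * (\<Prod>i<p. (s i)^2)"
    unfolding \<open>c = d\<close> d_def prod_power_distrib by (simp add: prod.distrib)
  finally have "Determinant.det A = (\<Prod>i<p. (s i)^2)" by simp
  then show ?thesis
    using that[of s l] s product density \<open>c = d\<close> by simp
qed

lemma distr_standardized_normal:
  assumes X: "distributed M (PiM {..<p} (\<lambda>_. lborel)) X
      (\<lambda>x. \<Prod>i<p. ennreal (normal_density (regression_mean \<mu> l i x) (s i) (x i)))"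
    and s: "\<And>i. i < p \<Longrightarrow> s i > 0"
  shows "distr M (PiM {..<p} (\<lambda>_. borel))
      (\<lambda>\<omega>. \<lambda>i\<in>{..<p}. (X \<omega> i - regression_mean \<mu> l i (X \<omega>)) / s i) = std_gaussian {..<p}"
    (is "distr M _ (\<lambda>\<omega>. ?Z (X \<omega>)) = _")
proof (rule std_gaussian.PiM_eqI)
  have sets: "sets (PiM {..<p} (\<lambda>_. lborel)) = sets (PiM {..<p} (\<lambda>_. borel :: real measure))"
    by (intro sets_PiM_cong) auto
  have Xm[measurable]: "X \<in> measurable M (PiM {..<p} (\<lambda>_. lborel))"
    using X by (rule distributed_measurable)
  have Zi: "(\<lambda>x. (x i - regression_mean \<mu> l i x) / s i) \<in> borel_measurable (PiM {..<p} (\<lambda>_. lborel))"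
    if "i < p" for i
    unfolding measurable_cong_sets[OF sets refl] using that
    by (intro borel_measurable_divide borel_measurable_diff borel_measurable_const
       measurable_regression_mean measurable_component_singleton) auto
  have Z: "?Z \<in> measurable (PiM {..<p} (\<lambda>_. lborel)) (PiM {..<p} (\<lambda>_. borel))"
    by (rule measurable_restrict) (use Zi in auto)
  fix A :: "nat \<Rightarrow> real set" assume A: "\<And>i. i \<in> {..<p} \<Longrightarrow> A i \<in> sets std_normal_distribution"
  define B where "B i = (if i < p then A i else {})" for i
  have B: "B i \<in> sets borel" for i using A by (simp add: B_def)
  have PiB: "Pi\<^sub>E {..<p} A = Pi\<^sub>E {..<p} B" by (intro PiE_cong) (simp add: B_def)
  have PiBm: "Pi\<^sub>E {..<p} B \<in> sets (PiM {..<p} (\<lambda>_. borel))" using B by (intro sets_PiM_I_finite) auto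
  have "emeasure (distr M (PiM {..<p} (\<lambda>_. borel)) (\<lambda>\<omega>. ?Z (X \<omega>))) (Pi\<^sub>E {..<p} A)
      = emeasure M ((\<lambda>\<omega>. ?Z (X \<omega>)) -` Pi\<^sub>E {..<p} B \<inter> space M)"
    unfolding PiB using measurable_compose[OF Xm Z] PiBm by (rule emeasure_distr)
  also have "\<dots> = (\<integral>\<^sup>+\<omega>. indicator ((\<lambda>\<omega>. ?Z (X \<omega>)) -` Pi\<^sub>E {..<p} B \<inter> space M) \<omega> \<partial>M)"
    by (rule nn_integral_indicator[OF measurable_sets[OF measurable_compose[OF Xm Z] PiBm], symmetric])
  also have "\<dots> = (\<integral>\<^sup>+\<omega>. indicator (Pi\<^sub>E {..<p} B) (?Z (X \<omega>)) \<partial>M)"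
    by (intro nn_integral_cong) (simp add: indicator_def)
  also have "\<dots> = (\<integral>\<^sup>+x. (\<Prod>i<p. ennreal (normal_density (regression_mean \<mu> l i x) (s i) (x i))) *
      indicator (Pi\<^sub>E {..<p} B) (?Z x) \<partial>PiM {..<p} (\<lambda>_. lborel))"
    by (rule distributed_nn_integral[OF X, symmetric])
      (rule measurable_compose[OF Z borel_measurable_indicator[OF PiBm]])
  also have "\<dots> = (\<integral>\<^sup>+x. (\<Prod>i<p. ennreal (normal_density (regression_mean \<mu> l i x) (s i) (x i)) *
      indicator (B i) ((x i - regression_mean \<mu> l i x) / s i)) \<partial>PiM {..<p} (\<lambda>_. lborel))"
  proof (intro nn_integral_cong)
    fix x :: "nat \<Rightarrow> real"
    have "indicator (Pi\<^sub>E {..<p} B) (?Z x) = (\<Prod>i<p. indicator (B i) ((x i - regression_mean \<mu> l i x) / s i) :: ennreal)"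
      unfolding indicator_def restrict_PiE_iff by (auto simp: prod_zero_iff intro!: prod.neutral)
    then show "(\<Prod>i<p. ennreal (normal_density (regression_mean \<mu> l i x) (s i) (x i))) *
      indicator (Pi\<^sub>E {..<p} B) (?Z x) = (\<Prod>i<p. ennreal (normal_density (regression_mean \<mu> l i x) (s i) (x i)) *
      indicator (B i) ((x i - regression_mean \<mu> l i x) / s i))"
      by (simp add: prod.distrib)
  qed
  also have "\<dots> = (\<Prod>i<p. \<integral>\<^sup>+z. indicator (B i) z \<partial>std_normal_distribution)"
    using s B by (intro nn_integral_triangular_normal) auto
  also have "\<dots> = (\<Prod>i<p. emeasure std_normal_distribution (A i))"
    by (intro prod.cong refl) (use A in \<open>auto simp: B_def\<close>)
  finally show "emeasure (distr M (PiM {..<p} (\<lambda>_. borel)) (\<lambda>\<omega>. ?Z (X \<omega>))) (Pi\<^sub>E {..<p} A)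
      = (\<Prod>i\<in>{..<p}. emeasure std_normal_distribution (A i))" .
qed (auto simp: sets_std_gaussian)

text \<open>
  The law of the full data matrix, with its entries indexed by pairs (column, row), so that columns
  can later be split off one at a time although independence is given by rows.
\<close>

lemma (in prob_space) distr_iid_std_gaussian_rows:
  fixes Y :: "'k \<Rightarrow> 'a \<Rightarrow> 'i \<Rightarrow> real"
  assumes K: "finite K" "K \<noteq> {}" and I: "finite I"
    and indep: "indep_vars (\<lambda>_. PiM I (\<lambda>_. borel)) Y K"
    and Y: "\<And>k. k \<in> K \<Longrightarrow> distr M (PiM I (\<lambda>_. borel)) (Y k) = std_gaussian I"
  shows "distr M (PiM (I \<times> K) (\<lambda>_. borel)) (\<lambda>\<omega>. \<lambda>q\<in>I \<times> K. Y (snd q) \<omega> (fst q)) = std_gaussian (I \<times> K)"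
    (is "distr M ?N ?Z = _")
proof (rule std_gaussian.PiM_eqI)
  have rv: "random_variable (PiM I (\<lambda>_. borel)) (Y k)" if "k \<in> K" for k
    using indep that by (auto simp: indep_vars_def)
  have Z: "?Z \<in> measurable M ?N"
  proof (rule measurable_restrict)
    fix q assume "q \<in> I \<times> K"
    then show "(\<lambda>\<omega>. Y (snd q) \<omega> (fst q)) \<in> borel_measurable M"
      by (intro measurable_compose[OF rv measurable_component_singleton]) auto
  qed
  fix A :: "'i \<times> 'k \<Rightarrow> real set" assume A: "\<And>q. q \<in> I \<times> K \<Longrightarrow> A q \<in> sets std_normal_distribution"
  define R where "R k = Pi\<^sub>E I (\<lambda>i. A (i, k))" for k
  have R: "R k \<in> sets (PiM I (\<lambda>_. borel))" if "k \<in> K" for k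
    unfolding R_def using A that I by (intro sets_PiM_I_finite) auto
  have "emeasure (distr M ?N ?Z) (Pi\<^sub>E (I \<times> K) A) = emeasure M (?Z -` Pi\<^sub>E (I \<times> K) A \<inter> space M)"
    using Z A K I by (intro emeasure_distr sets_PiM_I_finite) auto
  also have "?Z -` Pi\<^sub>E (I \<times> K) A \<inter> space M = (\<Inter>k\<in>K. Y k -` R k \<inter> space M)"
  proof -
    have "Y k \<omega> \<in> extensional I" if "k \<in> K" "\<omega> \<in> space M" for k \<omega>
      using measurable_space[OF rv[OF that(1)] that(2)] by (simp add: space_PiM PiE_iff)
    then show ?thesis
      using K(2) by (auto simp: R_def PiE_iff)
  qed
  also have "emeasure M \<dots> = (\<Prod>k\<in>K. emeasure M (Y k -` R k \<inter> space M))"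
    using indep_varsD_finite[OF indep K(2,1) R]
    by (simp add: emeasure_eq_measure prod_ennreal)
  also have "\<dots> = (\<Prod>k\<in>K. emeasure (std_gaussian I) (R k))"
  proof (intro prod.cong refl)
    fix k assume k: "k \<in> K"
    show "emeasure M (Y k -` R k \<inter> space M) = emeasure (std_gaussian I) (R k)"
      unfolding Y[OF k, symmetric] by (rule emeasure_distr[OF rv[OF k] R[OF k], symmetric])
  qed
  also have "\<dots> = (\<Prod>k\<in>K. \<Prod>i\<in>I. emeasure std_normal_distribution (A (i, k)))"
    unfolding R_def using A by (intro prod.cong refl std_gaussian.emeasure_PiM I) auto
  also have "\<dots> = (\<Prod>q\<in>I \<times> K. emeasure std_normal_distribution (A q))"
    by (subst prod.swap) (simp add: prod.cartesian_product)
  finally show "emeasure (distr M ?N ?Z) (Pi\<^sub>E (I \<times> K) A) = (\<Prod>q\<in>I \<times> K. emeasure std_normal_distribution (A q))" .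
qed (use K I in \<open>auto simp: sets_std_gaussian\<close>)

section \<open>The logarithm of the Gamma function on a vertical line\<close>

text \<open>
  Comparison with telescoping series: \<open>1 / (x * (x + 1)) \<le> 1 / x\<^sup>2\<close>, and from the second term on
  \<open>1 / x\<^sup>2 \<le> 1 / ((x - 1) * x)\<close>.
\<close>

lemma reciprocal_square_sum_bounds:
  fixes a :: real
  assumes a: "a > 0" and s: "(\<lambda>k. inverse ((a + real k)^2)) sums S"
  shows "1 / a \<le> S" "S \<le> 1 / a + 1 / a^2"
proof -
  have tele: "(\<lambda>k. inverse (a + real k) - inverse (a + real (Suc k))) sums (inverse a)"
  proof -
    have "(\<lambda>k. inverse (a + real k)) \<longlonglongrightarrow> 0"
      by (rule tendsto_inverse_0_at_top)
         (rule filterlim_tendsto_add_at_top[OF tendsto_const filterlim_real_sequentially])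
    from telescope_sums'[OF this] show ?thesis by simp
  qed
  have "inverse a \<le> S"
  proof (rule sums_le[OF _ tele s])
    fix k
    have "inverse (a + real k) - inverse (a + real (Suc k)) = inverse ((a + real k) * (a + real k + 1))"
      using a by (simp add: field_simps add_pos_nonneg)
    also have "\<dots> \<le> inverse ((a + real k)^2)"
      using a by (intro le_imp_inverse_le) (auto simp: power2_eq_square)
    finally show "inverse (a + real k) - inverse (a + real (Suc k)) \<le> inverse ((a + real k)^2)" .
  qed
  then show "1 / a \<le> S" by (simp add: divide_inverse)
  have s': "(\<lambda>k. inverse ((a + real (Suc k))^2)) sums (S - inverse (a^2))"
    using s by (subst sums_Suc_iff) simp
  have "S - inverse (a^2) \<le> inverse a"
  proof (rule sums_le[OF _ s' tele])
    fix k
    have "inverse ((a + real (Suc k))^2) \<le> inverse ((a + real k) * (a + real k + 1))"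
      using a by (intro le_imp_inverse_le) (auto simp: power2_eq_square intro!: mult_mono)
    also have "\<dots> = inverse (a + real k) - inverse (a + real (Suc k))"
      using a by (simp add: field_simps add_pos_nonneg)
    finally show "inverse ((a + real (Suc k))^2) \<le> inverse (a + real k) - inverse (a + real (Suc k))" .
  qed
  then show "S \<le> 1 / a + 1 / a^2" by (simp add: divide_inverse)
qed

lemma trigamma_bounds:
  fixes a :: real
  assumes a: "a > 0"
  shows "1 / a \<le> Polygamma 1 a" "Polygamma 1 a \<le> 1 / a + 1 / a^2"
proof -
  have "(\<lambda>k. inverse ((a + real k)^2)) sums Polygamma 1 a"
    using Polygamma_LIMSEQ[of a 1] a by (simp add: numeral_2_eq_2)
  from reciprocal_square_sum_bounds[OF a this]
  show "1 / a \<le> Polygamma 1 a" "Polygamma 1 a \<le> 1 / a + 1 / a^2" .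
qed

text \<open>
  On the line \<open>Re z = a\<close> the series for the second derivative of the digamma function is dominated by
  \<open>2 * (\<Sum>k. 1 / (a + k)\<^sup>3)\<close>, and pulling out one factor \<open>1 / a\<close> leaves the trigamma series at \<open>a\<close>.
\<close>

lemma norm_Polygamma_2_le:
  fixes z :: complex
  assumes a: "a > 0" and z: "Re z = a"
  shows "norm (Polygamma 2 z) \<le> 2 * (1 / a^2 + 1 / a^3)"
proof -
  have z0: "z \<noteq> 0" using a z by auto
  have n: "norm (z + of_nat k) \<ge> a + real k" for k
    using complex_Re_le_cmod[of "z + of_nat k"] z by simp
  have s2: "(\<lambda>k. inverse ((a + real k)^2)) sums Polygamma 1 a"
    using Polygamma_LIMSEQ[of a 1] a by (simp add: numeral_2_eq_2)
  have le: "norm (inverse ((z + of_nat k)^3)) \<le> (1/a) * inverse ((a + real k)^2)" for k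
  proof -
    have "norm (inverse ((z + of_nat k)^3)) = inverse (norm (z + of_nat k) ^ 3)"
      by (simp add: norm_inverse norm_power)
    also have "\<dots> \<le> inverse ((a + real k)^3)"
      using a n[of k] by (intro le_imp_inverse_le power_mono) auto
    also have "\<dots> \<le> inverse (a * (a + real k)^2)"
      using a by (intro le_imp_inverse_le) (auto simp: power3_eq_cube power2_eq_square intro!: mult_right_mono)
    finally show ?thesis by (simp add: divide_inverse)
  qed
  have sm: "summable (\<lambda>k. (1/a) * inverse ((a + real k)^2))"
    using s2 by (intro summable_mult) (auto simp: sums_iff)
  have "norm (\<Sum>k. inverse ((z + of_nat k)^3)) \<le> (\<Sum>k. (1/a) * inverse ((a + real k)^2))"
    by (rule norm_suminf_le[OF le sm])
  also have "\<dots> = (1/a) * Polygamma 1 a"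
    using sums_mult[OF s2, of "1/a"] by (simp add: sums_iff)
  also have "\<dots> \<le> (1/a) * (1/a + 1/a^2)"
    using a trigamma_bounds(2)[OF a] by (intro mult_left_mono) auto
  also have "\<dots> = 1 / a^2 + 1 / a^3"
    using a by (simp add: field_simps power2_eq_square power3_eq_cube)
  finally have "norm (\<Sum>k. inverse ((z + of_nat k)^3)) \<le> 1 / a^2 + 1 / a^3" .
  moreover have "Polygamma 2 z = - 2 * (\<Sum>k. inverse ((z + of_nat k)^3))"
    by (simp add: Polygamma_def numeral_3_eq_3 fact_numeral numeral_2_eq_2)
  ultimately show ?thesis by (simp add: norm_mult)
qed

text \<open>
  The logarithm of the characteristic function of the centred logarithm of a Gamma variable, minus its
  Gaussian approximation with variance \<open>1 / a\<close>.
\<close>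

definition log_Gamma_char_remainder :: "real \<Rightarrow> real \<Rightarrow> complex" where
  "log_Gamma_char_remainder a s =
     ln_Gamma (Complex a s) - ln_Gamma (of_real a) - \<i> * s * Digamma a + s^2 / (2 * a)"

text \<open>
  Second-order Taylor expansion of \<open>ln_Gamma\<close> at \<open>a\<close> along the vertical line through \<open>a\<close>.  The cubic
  error comes from the bound on the third derivative; the quadratic one from replacing the exact variance
  \<open>Polygamma 1 a\<close> by \<open>1 / a\<close>.
\<close>

lemma log_Gamma_char_remainder_bound:
  fixes a s :: real
  assumes a: "a \<ge> 1/2"
  shows "norm (log_Gamma_char_remainder a s) \<le> (s^2 + 3 * \<bar>s\<bar>^3) / a^2"
proof -
  define f :: "nat \<Rightarrow> complex \<Rightarrow> complex" where
    "f = (\<lambda>i. case i of 0 \<Rightarrow> ln_Gamma | Suc k \<Rightarrow> Polygamma k)"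
  define S where "S = {z. Re z = a}"
  have a0: "a > 0" using a by simp
  have der: "(f i has_field_derivative f (Suc i) x) (at x within S)" if "x \<in> S" for i x
  proof -
    have "x \<notin> \<real>\<^sub>\<le>\<^sub>0" "x \<notin> \<int>\<^sub>\<le>\<^sub>0"
      using that a0 by (auto simp: S_def complex_nonpos_Reals_iff elim!: nonpos_Ints_cases)
    then show ?thesis
      by (cases i) (auto simp: f_def intro: has_field_derivative_Polygamma
            intro!: has_field_derivative_at_within[OF has_field_derivative_ln_Gamma_complex])
  qed
  have c: "convex S" unfolding S_def by (rule convex_hyperplane[of "1::complex" a, simplified])
  have B: "norm (f (Suc 2) x) \<le> 2 * (1 / a^2 + 1 / a^3)" if "x \<in> S" for x
    using norm_Polygamma_2_le[OF a0, of x] that by (simp add: f_def S_def)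
  have w: "of_real a \<in> S" "Complex a s \<in> S" by (auto simp: S_def)
  have d: "Complex a s - of_real a = \<i> * s" by (simp add: complex_eq_iff)
  have 1: "norm (f 0 (Complex a s) - (\<Sum>i\<le>2. f i (of_real a) * (\<i> * s) ^ i / fact i))
      \<le> 2 * (1 / a^2 + 1 / a^3) * norm (\<i> * s) ^ Suc 2 / fact 2"
    using complex_Taylor[OF c der B w(1) w(2)] unfolding d by simp
  have "(\<Sum>i\<le>2. f i (of_real a) * (\<i> * s) ^ i / fact i)
      = ln_Gamma (of_real a) + \<i> * s * Digamma a - s^2 / 2 * Polygamma 1 a"
    using a0 by (simp add: f_def numeral_2_eq_2 atMost_Suc Polygamma_of_real power_mult_distrib)
  then have "f 0 (Complex a s) - (\<Sum>i\<le>2. f i (of_real a) * (\<i> * s) ^ i / fact i)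
      = ln_Gamma (Complex a s) - ln_Gamma (of_real a) - \<i> * s * Digamma a + s^2 / 2 * Polygamma 1 a"
    by (simp add: f_def)
  moreover have "2 * (1 / a^2 + 1 / a^3) * norm (\<i> * s) ^ Suc 2 / fact 2
      = (1 / a^2 + 1 / a^3) * \<bar>s\<bar>^3"
    by (simp add: norm_mult numeral_3_eq_3 numeral_2_eq_2)
  ultimately have 2: "norm (ln_Gamma (Complex a s) - ln_Gamma (of_real a) - \<i> * s * Digamma a
      + s^2 / 2 * Polygamma 1 a) \<le> (1 / a^2 + 1 / a^3) * \<bar>s\<bar>^3"
    using 1 by (simp only:)
  have "log_Gamma_char_remainder a s = (ln_Gamma (Complex a s) - ln_Gamma (of_real a)
      - \<i> * s * Digamma a + s^2 / 2 * Polygamma 1 a) - of_real (s^2 / 2 * (Polygamma 1 a - 1 / a))"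
    by (simp add: log_Gamma_char_remainder_def field_simps)
  also have "norm \<dots> \<le> (1 / a^2 + 1 / a^3) * \<bar>s\<bar>^3 + \<bar>s^2 / 2 * (Polygamma 1 a - 1 / a)\<bar>"
    by (rule order_trans[OF norm_triangle_ineq4]) (intro add_mono 2, simp only: norm_of_real order_refl)
  also have "\<bar>s^2 / 2 * (Polygamma 1 a - 1 / a)\<bar> \<le> s^2 / 2 * (1 / a^2)"
    using trigamma_bounds[OF a0] unfolding abs_mult by (intro mult_mono) auto
  also have "(1 / a^2 + 1 / a^3) * \<bar>s\<bar>^3 \<le> (1 / a^2 + 2 / a^2) * \<bar>s\<bar>^3"
    using a by (intro mult_right_mono zero_le_power abs_ge_zero)
        (simp add: field_simps power2_eq_square power3_eq_cube)
  also have "(1 / a^2 + 2 / a^2) * \<bar>s\<bar>^3 + s^2 / 2 * (1 / a^2) \<le> (s^2 + 3 * \<bar>s\<bar>^3) / a^2"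
    using a0 by (simp add: divide_simps add_pos_pos)
  finally show ?thesis by simp
qed

lemma Gamma_char_eq_exp:
  assumes a: "a > 0"
  shows "Gamma (Complex a s) / Gamma (of_real a) * exp (- (\<i> * s * Digamma a))
     = exp (log_Gamma_char_remainder a s - s^2 / (2 * a))"
proof -
  have "of_real a \<notin> (\<int>\<^sub>\<le>\<^sub>0 :: complex set)" "Complex a s \<notin> \<int>\<^sub>\<le>\<^sub>0"
    using a by (auto elim!: nonpos_Ints_cases simp: complex_eq_iff)
  then have "Gamma (Complex a s) = exp (ln_Gamma (Complex a s))"
    "Gamma (complex_of_real a) = exp (ln_Gamma (of_real a))"
    by (simp_all add: Gamma_complex_altdef)
  then have "Gamma (Complex a s) / Gamma (of_real a) * exp (- (\<i> * s * Digamma a))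
     = exp (ln_Gamma (Complex a s) - ln_Gamma (of_real a) + - (\<i> * s * Digamma a))"
    by (simp only: exp_add exp_diff)
  then show ?thesis
    by (simp add: log_Gamma_char_remainder_def)
qed

section \<open>The characteristic function of the standardized log-determinant\<close>

text \<open>
  Three triangular changes of vectors link the centred data columns to the residuals: a unit
  triangular one from the centred data to the scaled centred errors, a diagonal one that removes the
  scales \<open>s i\<close>, and the unit triangular one of Gram-Schmidt.  Only the diagonal one changes the Gram
  determinant.
\<close>

lemma det_sample_covariance:
  fixes X :: "nat \<Rightarrow> 'a \<Rightarrow> nat \<Rightarrow> real" and z :: "nat \<times> nat \<Rightarrow> real"
  assumes z: "\<And>i k. i < p \<Longrightarrow> k \<in> {1..n+1} \<Longrightarrow>
      s i * z (i, k) = X k \<omega> i - regression_mean \<mu> l i (X k \<omega>)"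
  shows "Determinant.det (sample_covariance n p X \<omega>)
       = (\<Prod>i<p. (s i)^2) * (\<Prod>i<p. residual_ss {1..n+1} i z) / real n ^ p"
proof -
  let ?K = "{1..n+1}"
  let ?G = "\<lambda>f. Determinant.det (gram_matrix p ?K f)"
  define x where "x i k = X k \<omega> i - sample_mean n X \<omega> i" for i k
  define c where "c i k = z (i, k) - (\<Sum>m\<in>?K. z (i, m)) / real (n + 1)" for i k
  define w where "w = gs_residual ?K (with_intercept z)"
  have "sample_covariance n p X \<omega> = (1 / real n) \<cdot>\<^sub>m gram_matrix p ?K x"
    by (rule eq_matI) (simp_all add: sample_covariance_def gram_matrix_def x_def)
  then have "Determinant.det (sample_covariance n p X \<omega>) = (1 / real n) ^ p * ?G x"
    by (simp add: det_smult gram_matrix_def)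
  moreover have "?G (\<lambda>i k. s i * c i k) = (\<Prod>i<p. 1)^2 * ?G x"
  proof -
    have "s i * c i k = (\<Sum>j\<le>i. (if j = i then 1 else - l i j) * x j k)" if i: "i < p" and k: "k \<in> ?K" for i k
    proof -
      have mean: "s i * ((\<Sum>m\<in>?K. z (i, m)) / real (n + 1))
          = sample_mean n X \<omega> i - \<mu> i - (\<Sum>j<i. l i j * (sample_mean n X \<omega> j - \<mu> j))"
      proof -
        have const: "(\<Sum>m\<in>?K. a) / real (n + 1) = a" for a :: real by simp
        have "s i * ((\<Sum>m\<in>?K. z (i, m)) / real (n + 1))
            = (\<Sum>m\<in>?K. X m \<omega> i - \<mu> i - (\<Sum>j<i. l i j * (X m \<omega> j - \<mu> j))) / real (n + 1)"
          using i by (simp add: sum_distrib_left z regression_mean_def diff_diff_add del: sum.cl_ivl_Suc)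
        also have "\<dots> = sample_mean n X \<omega> i - (\<Sum>m\<in>?K. \<mu> i) / real (n + 1)
            - (\<Sum>m\<in>?K. \<Sum>j<i. l i j * (X m \<omega> j - \<mu> j)) / real (n + 1)"
          by (simp only: sum_subtractf diff_divide_distrib sample_mean_def)
        also have "(\<Sum>m\<in>?K. \<Sum>j<i. l i j * (X m \<omega> j - \<mu> j)) / real (n + 1)
            = (\<Sum>j<i. l i j * ((\<Sum>m\<in>?K. X m \<omega> j - \<mu> j) / real (n + 1)))"
          by (subst sum.swap, subst sum_divide_distrib) (simp only: sum_distrib_left[symmetric] times_divide_eq_right)
        also have "\<dots> = (\<Sum>j<i. l i j * (sample_mean n X \<omega> j - \<mu> j))"
          by (simp only: sum_subtractf diff_divide_distrib sample_mean_def const)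
        finally show ?thesis by (simp only: const)
      qed
      have "s i * c i k = s i * z (i, k) - s i * ((\<Sum>m\<in>?K. z (i, m)) / real (n + 1))"
        by (simp only: c_def right_diff_distrib)
      also have "\<dots> = x i k - (\<Sum>j<i. l i j * (X k \<omega> j - \<mu> j)) + (\<Sum>j<i. l i j * (sample_mean n X \<omega> j - \<mu> j))"
        unfolding mean z[OF i k] by (simp add: x_def regression_mean_def)
      also have "\<dots> = x i k - (\<Sum>j<i. l i j * x j k)"
      proof -
        have "(\<Sum>j<i. l i j * (X k \<omega> j - \<mu> j)) - (\<Sum>j<i. l i j * (sample_mean n X \<omega> j - \<mu> j))
            = (\<Sum>j<i. l i j * x j k)"
          unfolding sum_subtractf[symmetric] by (intro sum.cong) (simp_all add: x_def algebra_simps)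
        then show ?thesis by simp
      qed
      also have "\<dots> = (\<Sum>j\<le>i. (if j = i then 1 else - l i j) * x j k)"
        by (simp add: lessThan_Suc_atMost[symmetric] sum_negf)
      finally show ?thesis .
    qed
    then show ?thesis
      by (subst det_gram_matrix_triangular[of p ?K _ "\<lambda>i j. if j = i then 1 else - l i j" x]) auto
  qed
  moreover have "?G (\<lambda>i k. s i * c i k) = (\<Prod>i<p. s i)^2 * ?G c"
    by (subst det_gram_matrix_triangular[of p ?K _ "\<lambda>i j. if j = i then s i else 0" c])
      (auto simp: if_distrib[of "\<lambda>t. t * _"] cong: if_cong)
  moreover have "?G c = (\<Prod>i<p. 1)^2 * ?G (\<lambda>i. w (Suc i))"
  proof -
    define b where "b i j = (if j = i then 1 else
      (\<Sum>m\<in>?K. z (i, m) * w (Suc j) m) / (\<Sum>m\<in>?K. (w (Suc j) m)^2))" for i j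
    have "c i k = (\<Sum>j\<le>i. b i j * w (Suc j) k)" for i k
    proof -
      have w0: "w 0 m = 1" for m by (simp add: w_def gs_residual_0)
      have "w (Suc i) k = z (i, k) - (\<Sum>j<Suc i. (\<Sum>m\<in>?K. z (i, m) * w j m) / (\<Sum>m\<in>?K. (w j m)^2) * w j k)"
        unfolding w_def by (subst gs_residual.simps) simp
      \<comment> \<open>The coefficient of the constant vector \<open>w 0\<close> is the mean of column \<open>i\<close>, so the term \<open>j = 0\<close> does
           the centring.\<close>
      also have "\<dots> = c i k - (\<Sum>j<i. b i j * w (Suc j) k)"
        by (subst sum.lessThan_Suc_shift) (simp add: w0 c_def b_def del: sum.cl_ivl_Suc)
      finally show ?thesis
        by (simp add: lessThan_Suc_atMost[symmetric] b_def)
    qed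
    then show ?thesis
      by (subst det_gram_matrix_triangular[of p ?K _ b "\<lambda>i. w (Suc i)"]) (auto simp: b_def)
  qed
  moreover have "?G (\<lambda>i. w (Suc i)) = (\<Prod>i<p. residual_ss ?K i z)"
    unfolding residual_ss_def w_def
    by (rule det_gram_matrix_orthogonal, rule gs_residual_orthogonal) auto
  ultimately show ?thesis
    by (simp add: prod_power_distrib power_divide)
qed

lemma tau_const_eq:
  assumes "n \<ge> 1"
  shows "tau_const n p = (\<Sum>i<p. Digamma ((real n - real i) / 2) + ln 2) - real p * ln (real n)"
proof -
  have "tau_const n p = (\<Sum>i<p. Digamma ((real n - real (Suc i) + 1) / 2) - ln (real n / 2))"
    unfolding tau_const_def One_nat_def by (rule sum.atLeast1_atMost_eq)
  then show ?thesis
    using assms by (simp add: ln_div sum.distrib sum_subtractf algebra_simps)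
qed

lemma sigma_const_eq: "sigma_const n p = sqrt (\<Sum>i<p. 2 / (real n - real i))"
proof -
  have "(\<Sum>k=1..p. 2 / (real n - real k + 1)) = (\<Sum>i<p. 2 / (real n - real (Suc i) + 1))"
    unfolding One_nat_def by (rule sum.atLeast1_atMost_eq)
  then show ?thesis by (simp add: sigma_const_def)
qed

text \<open>
  Centring the logarithm of a chi-square variable at \<open>Digamma (r / 2) + ln 2\<close> cancels the scale factor
  \<open>2\<close> and the linear term of the Taylor expansion.
\<close>

lemma chi_square_char_centred:
  assumes "r > 0"
  shows "chi_square_char r u * iexp (- (u * (Digamma (r / 2) + ln 2)))
       = exp (log_Gamma_char_remainder (r / 2) u - u^2 / r)"
proof -
  define a where "a = r / 2"
  have "iexp (- (u * (Digamma a + ln 2))) = exp (- (\<i> * u * Digamma a)) * iexp (- (u * ln 2))"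
    unfolding exp_add[symmetric] by (simp add: ring_distribs mult.assoc)
  then have "chi_square_char r u * iexp (- (u * (Digamma a + ln 2)))
      = iexp (u * ln 2) * Gamma (Complex a u) / of_real (Gamma a) *
        (exp (- (\<i> * u * Digamma a)) * iexp (- (u * ln 2)))"
    by (simp only: chi_square_char_def a_def[symmetric])
  also have "\<dots> = (iexp (u * ln 2) * iexp (- (u * ln 2))) *
        (Gamma (Complex a u) / of_real (Gamma a) * exp (- (\<i> * u * Digamma a)))"
    by (simp only: times_divide_eq_left times_divide_eq_right mult_ac)
  also have "iexp (u * ln 2) * iexp (- (u * ln 2)) = 1"
    unfolding exp_add[symmetric] by simp
  finally have "chi_square_char r u * iexp (- (u * (Digamma a + ln 2)))
      = Gamma (Complex a u) / Gamma (of_real a) * exp (- (\<i> * u * Digamma a))"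
    by (simp only: mult_1_left Gamma_complex_of_real)
  then show ?thesis
    using assms Gamma_char_eq_exp[of a u] by (simp add: a_def)
qed

text \<open>
  The statistic is a function of the standardized errors, whose joint law is standard Gaussian.  By
  \<open>det_sample_covariance\<close> the logarithm of \<open>det A\<close> cancels, up to the null set where a residual
  vanishes, and the constant \<open>tau_const n p + p * ln n\<close> distributes the centring over the factors.
\<close>

lemma char_standardized_log_det:
  fixes X :: "nat \<Rightarrow> 'a \<Rightarrow> nat \<Rightarrow> real" and A :: "real mat"
  assumes p: "1 \<le> p" "p \<le> n" and A: "positive_definite_mat p A" and M: "prob_space M"
    and indep: "prob_space.indep_vars M (\<lambda>_. PiM {..<p} (\<lambda>_. borel)) X {1..n+1}"
    and X: "\<And>k. k \<in> {1..n+1} \<Longrightarrow> distributed M (PiM {..<p} (\<lambda>_. lborel)) (X k)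
             (\<lambda>x. ennreal (multivariate_normal_density p \<mu> A x))"
  defines "S \<equiv> \<lambda>\<omega>. (ln (Determinant.det (sample_covariance n p X \<omega>)) - tau_const n p
      - ln (Determinant.det A)) / sigma_const n p"
  shows "S \<in> borel_measurable M"
    and "char (distr M borel S) t = exp (\<Sum>i<p. log_Gamma_char_remainder ((real n - real i) / 2) (t / sigma_const n p)
      - (t / sigma_const n p)^2 / (real n - real i))"
proof -
  let ?K = "{1..n+1}"
  let ?N = "PiM ({..<p} \<times> ?K) (\<lambda>_. borel :: real measure)"
  let ?G = "std_gaussian ({..<p} \<times> ?K)"
  define L :: "(nat \<Rightarrow> real) measure" where "L = PiM {..<p} (\<lambda>_. lborel)"
  interpret prob_space M by fact
  have fin: "finite ?K" "?K \<noteq> {}" and card: "card ?K = n + 1" by auto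
  have total: "(\<integral>\<^sup>+x. ennreal (multivariate_normal_density p \<mu> A x) \<partial>L) = 1"
  proof -
    have d: "distributed M L (X 1) (\<lambda>x. ennreal (multivariate_normal_density p \<mu> A x))"
      using X[of 1] by (simp add: L_def)
    have "(\<integral>\<^sup>+x. ennreal (multivariate_normal_density p \<mu> A x) \<partial>L)
        = (\<integral>\<^sup>+x. ennreal (multivariate_normal_density p \<mu> A x) * 1 \<partial>L)" by simp
    also have "\<dots> = (\<integral>\<^sup>+\<omega>. 1 \<partial>M)"
      by (rule distributed_nn_integral[OF d]) simp
    finally show ?thesis by (simp add: emeasure_space_1)
  qed
  obtain l s where s: "\<And>i. i < p \<Longrightarrow> 0 < s i" and detA: "Determinant.det A = (\<Prod>i<p. (s i)^2)"
    and density: "\<And>x. multivariate_normal_density p \<mu> A x = (\<Prod>i<p. normal_density (regression_mean \<mu> l i x) (s i) (x i))"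
    using normal_density_regression_factorization[OF A total[unfolded L_def]] by metis
  define Y where "Y k \<omega> = (\<lambda>i\<in>{..<p}. (X k \<omega> i - regression_mean \<mu> l i (X k \<omega>)) / s i)" for k \<omega>
  define Z where "Z \<omega> = (\<lambda>q\<in>{..<p} \<times> ?K. Y (snd q) \<omega> (fst q))" for \<omega>
  have Ymeas: "(\<lambda>x. \<lambda>i\<in>{..<p}. (x i - regression_mean \<mu> l i x) / s i)
      \<in> measurable (PiM {..<p} (\<lambda>_. borel)) (PiM {..<p} (\<lambda>_. borel))"
  proof (rule measurable_restrict)
    fix i assume "i \<in> {..<p}"
    then show "(\<lambda>x. (x i - regression_mean \<mu> l i x) / s i) \<in> borel_measurable (PiM {..<p} (\<lambda>_. borel))"
      by (intro borel_measurable_divide borel_measurable_diff borel_measurable_const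
        measurable_regression_mean measurable_component_singleton) auto
  qed
  have Yindep: "indep_vars (\<lambda>_. PiM {..<p} (\<lambda>_. borel)) Y ?K"
    unfolding Y_def[abs_def] using indep Ymeas by (rule indep_vars_compose2)
  have "distr M (PiM {..<p} (\<lambda>_. borel)) (Y k) = std_gaussian {..<p}" if k: "k \<in> ?K" for k
  proof -
    have "(\<lambda>x. ennreal (multivariate_normal_density p \<mu> A x))
        = (\<lambda>x. \<Prod>i<p. ennreal (normal_density (regression_mean \<mu> l i x) (s i) (x i)))"
      by (intro ext) (simp add: density prod_ennreal)
    then show ?thesis
      unfolding Y_def[abs_def] using X[OF k] s by (intro distr_standardized_normal) auto
  qed
  then have Zdistr: "distr M ?N Z = ?G"
    unfolding Z_def[abs_def] using fin Yindep by (intro distr_iid_std_gaussian_rows) auto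
  have Zmeas: "Z \<in> measurable M ?N"
    unfolding Z_def
  proof (rule measurable_restrict)
    fix q assume "q \<in> {..<p} \<times> ?K"
    then show "(\<lambda>\<omega>. Y (snd q) \<omega> (fst q)) \<in> borel_measurable M"
      using Yindep measurable_compose[of "Y (snd q)" M "PiM {..<p} (\<lambda>_. borel)" "\<lambda>x. x (fst q)" borel]
      unfolding indep_vars_def by (auto intro: measurable_component_singleton)
  qed
  define R where "R z = (\<Prod>i<p. residual_ss ?K i z)" for z :: "nat \<times> nat \<Rightarrow> real"
  define T where "T z = (ln (Determinant.det A * R z / real n ^ p) - tau_const n p - ln (Determinant.det A)) / sigma_const n p" for z
  have S: "S = (\<lambda>\<omega>. T (Z \<omega>))"
  proof
    fix \<omega>
    have "Determinant.det (sample_covariance n p X \<omega>)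
       = (\<Prod>i<p. (s i)^2) * (\<Prod>i<p. residual_ss ?K i (Z \<omega>)) / real n ^ p"
    proof (rule det_sample_covariance)
      fix i k assume "i < p" "k \<in> ?K"
      then show "s i * Z \<omega> (i, k) = X k \<omega> i - regression_mean \<mu> l i (X k \<omega>)"
        using s[of i] by (simp add: Z_def Y_def)
    qed
    then show "S \<omega> = T (Z \<omega>)"
      unfolding S_def T_def R_def detA by simp
  qed
  have R: "R \<in> borel_measurable ?N"
    unfolding R_def[abs_def] by (intro borel_measurable_prod measurable_residual_ss) auto
  then have T: "T \<in> borel_measurable ?N"
    unfolding T_def[abs_def] by measurable
  show "S \<in> borel_measurable M"
    unfolding S using Zmeas T by (rule measurable_compose)
  define u where "u = t / sigma_const n p"
  have detA0: "Determinant.det A > 0" unfolding detA by (intro prod_pos ballI zero_less_power s) auto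
  have n: "n \<ge> 1" using p by simp
  have sets: "sets ?G = sets ?N" by (rule sets_std_gaussian)
  have "char (distr M borel S) t = (\<integral>\<omega>. iexp (t * T (Z \<omega>)) \<partial>M)"
    unfolding char_def using \<open>S \<in> borel_measurable M\<close> by (subst integral_distr) (auto simp: S)
  also have "\<dots> = (\<integral>z. iexp (t * T z) \<partial>distr M ?N Z)"
    using Zmeas T by (subst integral_distr) auto
  also have "\<dots> = (\<integral>z. iexp (u * ln (R z)) * iexp (- (u * (real p * ln (real n) + tau_const n p))) \<partial>?G)"
    unfolding Zdistr
  proof (rule integral_cong_AE)
    show "(\<lambda>z. iexp (t * T z)) \<in> borel_measurable ?G"
      unfolding measurable_cong_sets[OF sets refl] using T by measurable
    show "(\<lambda>z. iexp (u * ln (R z)) * iexp (- (u * (real p * ln (real n) + tau_const n p)))) \<in> borel_measurable ?G"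
      unfolding measurable_cong_sets[OF sets refl] using R by measurable
    have "AE z in ?G. \<forall>i<p. 0 < residual_ss ?K i z"
      using p by (intro AE_residual_ss_pos) auto
    then show "AE z in ?G. iexp (t * T z) = iexp (u * ln (R z)) * iexp (- (u * (real p * ln (real n) + tau_const n p)))"
    proof eventually_elim
      case (elim z)
      then have "R z > 0" unfolding R_def by (intro prod_pos) auto
      then have lnR: "ln (Determinant.det A * R z / real n ^ p) = ln (Determinant.det A) + ln (R z) - real p * ln (real n)"
        using detA0 n by (simp add: ln_div ln_mult ln_realpow)
      have "t * T z = u * ln (R z) + - (u * (real p * ln (real n) + tau_const n p))"
        unfolding T_def lnR u_def by (simp add: diff_divide_distrib add_divide_distrib algebra_simps)
      then show ?case by (simp add: ring_distribs exp_add[symmetric])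
    qed
  qed
  also have "\<dots> = (\<integral>z. iexp (u * ln (R z)) \<partial>?G) * iexp (- (u * (real p * ln (real n) + tau_const n p)))"
    by (rule integral_mult_left_zero)
  also have "(\<integral>z. iexp (u * ln (R z)) \<partial>?G) = (\<Prod>i<p. chi_square_char (real n - real i) u)"
    unfolding R_def using p by (subst integral_iexp_ln_residual_ss) (auto simp: card)
  also have "iexp (- (u * (real p * ln (real n) + tau_const n p)))
      = iexp (\<Sum>i<p. - (u * (Digamma ((real n - real i) / 2) + ln 2)))"
    unfolding tau_const_eq[OF n] by (simp add: sum_distrib_left sum_negf)
  also have "\<dots> = (\<Prod>i<p. iexp (- (u * (Digamma ((real n - real i) / 2) + ln 2))))"
    by (simp only: of_real_sum sum_distrib_left exp_sum[OF finite_lessThan])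
  also have "(\<Prod>i<p. chi_square_char (real n - real i) u) * \<dots>
      = (\<Prod>i<p. exp (log_Gamma_char_remainder ((real n - real i) / 2) u - u^2 / (real n - real i)))"
    unfolding prod.distrib[symmetric] using p
    by (intro prod.cong refl) (subst chi_square_char_centred, auto)
  also have "\<dots> = exp (\<Sum>i<p. log_Gamma_char_remainder ((real n - real i) / 2) u - u^2 / (real n - real i))"
    by (simp add: exp_sum)
  finally show "char (distr M borel S) t = exp (\<Sum>i<p. log_Gamma_char_remainder ((real n - real i) / 2) (t / sigma_const n p)
      - (t / sigma_const n p)^2 / (real n - real i))"
    by (simp add: u_def)
qed

section \<open>The limit\<close>

text \<open>
  Induction on \<open>p\<close>, in the form \<open>1 / m\<^sup>2 \<le> 2 / m - 2 / (m + 1)\<close> for \<open>m \<ge> 1\<close>.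
\<close>

lemma sum_inverse_squares_le:
  assumes "p \<le> n"
  shows "(\<Sum>i<p. 1 / (real n - real i)^2) \<le> 2 / (real n - real p + 1)"
  using assms
proof (induction p)
  case (Suc p)
  define m where "m = real n - real p"
  have m: "m \<ge> 1" using Suc.prems by (simp add: m_def)
  have "(\<Sum>i<Suc p. 1 / (real n - real i)^2) \<le> 2 / (m + 1) + 1 / m^2"
    using Suc by (simp add: m_def)
  also have "\<dots> \<le> 2 / m"
    using m by (simp add: divide_simps power2_eq_square) (simp add: algebra_simps)
  finally show ?case by (simp add: m_def)
qed simp

lemma ln_le_sum_reciprocals:
  assumes "p \<le> n"
  shows "ln ((real n + 1) / (real n - real p + 1)) \<le> (\<Sum>i<p. 1 / (real n - real i))"
  using assms
proof (induction p)
  case (Suc p)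
  define m where "m = real n - real p"
  have m: "m \<ge> 1" using Suc.prems by (simp add: m_def)
  have "ln ((real n + 1) / m) = ln ((real n + 1) / (m + 1)) + ln (1 + 1 / m)"
  proof -
    have "(real n + 1) / m = (real n + 1) / (m + 1) * (1 + 1 / m)"
      using m by (simp add: divide_simps)
    then show ?thesis
      using m by (simp only:) (intro ln_mult_pos, auto intro!: add_pos_pos divide_pos_pos)
  qed
  also have "\<dots> \<le> (\<Sum>i<p. 1 / (real n - real i)) + 1 / m"
    using Suc m by (intro add_mono ln_add_one_self_le_self) (auto simp: m_def)
  finally show ?case by (simp add: m_def)
qed simp

text \<open>
  Here \<open>V\<close> is the squared \<open>sigma_const n p\<close>, and \<open>U\<close> bounds the accumulated Taylor errors before scaling.
  Let \<open>m\<close> be the smallest number of degrees of freedom.  Termwise \<open>U \<le> 2 / m * V\<close>, and \<open>V \<ge> 2 / m\<close>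
  because the last term is \<open>2 / m\<close>; this settles the case \<open>m \<ge> sqrt (n + 1)\<close>.  Otherwise \<open>V\<close> is
  at least \<open>2 * ln ((n + 1) / m) \<ge> ln (n + 1)\<close>, while \<open>U \<le> 8\<close>.  The bound \<open>\<delta>\<close> adds up what the two
  cases need, so it does not depend on \<open>p\<close>.
\<close>

lemma reciprocal_sums_ratio_bounds:
  fixes n p :: nat
  assumes "1 \<le> p" "p \<le> n"
  defines "V \<equiv> \<Sum>i<p. 2 / (real n - real i)" and "U \<equiv> \<Sum>i<p. 4 / (real n - real i)^2"
    and "\<delta> \<equiv> 2 / sqrt (real n + 1) + 2 / sqrt (sqrt (real n + 1)) + 8 / ln (real n + 1) + 8 / ln (real n + 1) / sqrt (ln (real n + 1))"
  shows "V > 0" "U / V \<le> \<delta>" "U / V / sqrt V \<le> \<delta>"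
proof -
  define m where "m = real n - real p + 1"
  define c where "c = real n + 1"
  have m1: "m \<ge> 1" using assms by (simp add: m_def)
  have c: "c > 1" "ln c > 0" using assms by (simp_all add: c_def)
  have pos: "real n - real i \<ge> m" if "i < p" for i
    using that assms by (simp add: m_def)
  have U0: "U \<ge> 0" unfolding U_def by (intro sum_nonneg) simp
  have "U = 4 * (\<Sum>i<p. 1 / (real n - real i)^2)" by (simp add: U_def sum_distrib_left)
  also have "\<dots> \<le> 4 * (2 / m)" using sum_inverse_squares_le[OF assms(2)] by (simp add: m_def)
  also have "\<dots> \<le> 8" using m1 by (simp add: field_simps)
  finally have U8: "U \<le> 8" .
  have "U \<le> (\<Sum>i<p. 2 / m * (2 / (real n - real i)))"
    unfolding U_def
  proof (rule sum_mono)
    fix i assume "i \<in> {..<p}"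
    then have "m \<le> real n - real i" using pos by simp
    then show "4 / (real n - real i)^2 \<le> 2 / m * (2 / (real n - real i))"
      using m1 by (simp add: power2_eq_square frac_le)
  qed
  then have UV: "U \<le> 2 / m * V" by (simp add: V_def sum_distrib_left)
  have "2 / m = (\<Sum>i\<in>{p - 1}. 2 / (real n - real i))" using assms by (simp add: m_def of_nat_diff)
  also have "\<dots> \<le> V"
    unfolding V_def using assms pos m1
    by (intro sum_mono2) (auto intro!: divide_nonneg_nonneg)
  finally have Vm: "2 / m \<le> V" .
  moreover have "0 < 2 / m" using m1 by simp
  ultimately show V0: "V > 0" by linarith
  have Vln: "2 * ln (c / m) \<le> V"
  proof -
    have "V = 2 * (\<Sum>i<p. 1 / (real n - real i))" by (simp add: V_def sum_distrib_left)
    then show ?thesis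
      using ln_le_sum_reciprocals[OF assms(2)] by (simp add: c_def m_def)
  qed
  have terms: "0 \<le> 2 / sqrt c" "0 \<le> 2 / sqrt (sqrt c)" "0 \<le> 8 / ln c" "0 \<le> 8 / ln c / sqrt (ln c)"
    using c by auto
  have "U / V \<le> \<delta> \<and> U / V / sqrt V \<le> \<delta>"
  proof (cases "m \<ge> sqrt c")
    case True
    have ratio: "U / V \<le> 2 / m" using UV V0 by (simp add: field_simps)
    have 1: "2 / m \<le> 2 / sqrt c"
      using True c m1 by (intro divide_left_mono mult_pos_pos) auto
    then have a: "U / V \<le> 2 / sqrt c" using ratio by simp
    have "U / V / sqrt V \<le> 2 / m / sqrt (2 / m)"
      using ratio Vm m1 by (intro order.refl frac_le[OF _ ratio]) auto
    also have "\<dots> = sqrt (2 / m)" by (rule real_div_sqrt) (use m1 in simp)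
    also have "\<dots> \<le> sqrt (2 / sqrt c)" using 1 by simp
    also have "\<dots> \<le> 2 / sqrt (sqrt c)"
      using c by (simp add: real_sqrt_divide divide_right_mono real_le_lsqrt)
    finally have b: "U / V / sqrt V \<le> 2 / sqrt (sqrt c)" .
    show ?thesis
      unfolding \<delta>_def c_def[symmetric] using a b terms by (intro conjI; linarith)
  next
    case False
    have "ln c = 2 * ln (c / sqrt c)" using c by (simp add: real_div_sqrt ln_sqrt)
    also have "\<dots> \<le> 2 * ln (c / m)" using False m1 c by (auto intro!: divide_left_mono simp: divide_simps)
    finally have L: "ln c \<le> V" using Vln by simp
    have a: "U / V \<le> 8 / ln c" using U8 U0 L c by (intro frac_le) auto
    have b: "U / V / sqrt V \<le> 8 / ln c / sqrt (ln c)"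
      by (rule frac_le) (use a L c in auto)
    show ?thesis
      unfolding \<delta>_def c_def[symmetric] using a b terms by (intro conjI; linarith)
  qed
  then show "U / V \<le> \<delta>" "U / V / sqrt V \<le> \<delta>" by auto
qed
text \<open>
  The common bound \<open>\<delta>\<close> of \<open>reciprocal_sums_ratio_bounds\<close>.
\<close>

definition error_rate :: "nat \<Rightarrow> real" where
  "error_rate n = 2 / sqrt (real n + 1) + 2 / sqrt (sqrt (real n + 1)) + 8 / ln (real n + 1)
     + 8 / ln (real n + 1) / sqrt (ln (real n + 1))"

lemma error_rate_tendsto_0: "error_rate \<longlonglongrightarrow> 0"
  unfolding error_rate_def[abs_def] by real_asymp

lemma log_char_error:
  assumes p: "1 \<le> p" "p \<le> n"
  shows "norm ((\<Sum>i<p. log_Gamma_char_remainder ((real n - real i) / 2) (t / sigma_const n p)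
      - (t / sigma_const n p)^2 / (real n - real i)) - of_real (- (t^2) / 2)) \<le> (t^2 + 3 * \<bar>t\<bar>^3) * error_rate n"
proof -
  define V where "V = (\<Sum>i<p. 2 / (real n - real i))"
  define U where "U = (\<Sum>i<p. 4 / (real n - real i)^2)"
  define u where "u = t / sqrt V"
  note bounds = reciprocal_sums_ratio_bounds[OF p, folded V_def U_def error_rate_def]
  have V: "V > 0" by (rule bounds(1))
  have u2: "u^2 = t^2 / V" using V by (simp add: u_def power_divide)
  have u3: "\<bar>u\<bar>^3 = \<bar>t\<bar>^3 / V / sqrt V"
  proof -
    have "\<bar>u\<bar>^3 = \<bar>t\<bar>^3 / (sqrt V)^3" using V by (simp add: u_def power_divide)
    also have "(sqrt V)^3 = V * sqrt V" using V by (simp add: power3_eq_cube)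
    finally show ?thesis by simp
  qed
  have "(\<Sum>i<p. u^2 / (real n - real i)) = u^2 / 2 * V"
    by (simp add: V_def sum_distrib_left)
  then have main: "(\<Sum>i<p. u^2 / (real n - real i)) = t^2 / 2" using V by (simp add: u2)
  have "norm (\<Sum>i<p. log_Gamma_char_remainder ((real n - real i) / 2) u)
      \<le> (\<Sum>i<p. (u^2 + 3 * \<bar>u\<bar>^3) / ((real n - real i) / 2)^2)"
    using p by (intro sum_norm_le log_Gamma_char_remainder_bound) auto
  also have "\<dots> = (u^2 + 3 * \<bar>u\<bar>^3) * U"
    by (simp add: U_def sum_distrib_left power_divide mult.commute)
  also have "\<dots> = t^2 * (U / V) + 3 * \<bar>t\<bar>^3 * (U / V / sqrt V)"
    unfolding u2 u3 by (simp add: algebra_simps)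
  also have "\<dots> \<le> t^2 * error_rate n + 3 * \<bar>t\<bar>^3 * error_rate n"
    using bounds(2,3) by (intro add_mono mult_left_mono) auto
  finally have "norm (\<Sum>i<p. log_Gamma_char_remainder ((real n - real i) / 2) u) \<le> (t^2 + 3 * \<bar>t\<bar>^3) * error_rate n"
    by (simp add: algebra_simps)
  moreover have "(\<Sum>i<p. log_Gamma_char_remainder ((real n - real i) / 2) u - of_real (u^2 / (real n - real i))) - of_real (- (t^2) / 2)
      = (\<Sum>i<p. log_Gamma_char_remainder ((real n - real i) / 2) u)"
    unfolding sum_subtractf of_real_sum[symmetric] main by simp
  ultimately show ?thesis
    by (simp add: sigma_const_eq V_def[symmetric] u_def[symmetric])
qed

theorem theorem1:
  fixes p :: "nat \<Rightarrow> nat"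
    and M :: "nat \<Rightarrow> 'a measure"
    and X :: "nat \<Rightarrow> nat \<Rightarrow> 'a \<Rightarrow> nat \<Rightarrow> real"
    and \<mu> :: "nat \<Rightarrow> nat \<Rightarrow> real"
    and \<Sigma> :: "nat \<Rightarrow> real mat"
  assumes "\<And>n. n \<ge> 1 \<Longrightarrow> 1 \<le> p n \<and> p n \<le> n"
    and "\<And>n. n \<ge> 1 \<Longrightarrow> positive_definite_mat (p n) (\<Sigma> n)"
    and "\<And>n. n \<ge> 1 \<Longrightarrow> prob_space (M n)"
    and "\<And>n. n \<ge> 1 \<Longrightarrow>
           prob_space.indep_vars (M n) (\<lambda>_. PiM {..<p n} (\<lambda>_. borel)) (X n) {1..n+1}"
    and "\<And>n k. n \<ge> 1 \<Longrightarrow> k \<in> {1..n+1} \<Longrightarrow>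
           distributed (M n) (PiM {..<p n} (\<lambda>_. lborel)) (X n k)
             (\<lambda>x. ennreal (multivariate_normal_density (p n) (\<mu> n) (\<Sigma> n) x))"
  shows "weak_conv_m
           (\<lambda>n. distr (M n) borel (\<lambda>\<omega>.
              (ln (Determinant.det (sample_covariance n (p n) (X n) \<omega>))
                 - tau_const n (p n) - ln (Determinant.det (\<Sigma> n))) / sigma_const n (p n)))
           std_normal_distribution"
proof -
  let ?D = "\<lambda>n. distr (M n) borel (\<lambda>\<omega>.
              (ln (Determinant.det (sample_covariance n (p n) (X n) \<omega>))
                 - tau_const n (p n) - ln (Determinant.det (\<Sigma> n))) / sigma_const n (p n))"
  let ?E = "\<lambda>t n. \<Sum>i<p n. log_Gamma_char_remainder ((real n - real i) / 2) (t / sigma_const n (p n))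
      - of_real ((t / sigma_const n (p n))^2 / (real n - real i))"
  \<comment> \<open>Levy's theorem needs a real distribution for every index, whereas nothing is known at \<open>n = 0\<close>.\<close>
  define D where "D n = (if n = 0 then std_normal_distribution else ?D n)" for n
  have char: "char (?D n) t = exp (?E t n)" if "n \<ge> 1" for n t
    using assms[OF that] by (subst char_standardized_log_det) auto
  have real_distr: "real_distribution (?D n)" if "n \<ge> 1" for n
    using assms[OF that] by (intro prob_space.real_distribution_distr char_standardized_log_det(1)) auto
  have "weak_conv_m D std_normal_distribution"
  proof (rule levy_continuity)
    show "real_distribution (D n)" for n
      using real_distr[of n] real_dist_normal_dist by (cases "n = 0") (auto simp: D_def)
    show "real_distribution std_normal_distribution" by (rule real_dist_normal_dist)
    fix t :: real
    have "(\<lambda>n. (t^2 + 3 * \<bar>t\<bar>^3) * error_rate n) \<longlonglongrightarrow> 0"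
      using tendsto_mult[OF tendsto_const error_rate_tendsto_0] by simp
    moreover have "eventually (\<lambda>n. norm (?E t n - of_real (- (t^2) / 2)) \<le> (t^2 + 3 * \<bar>t\<bar>^3) * error_rate n) sequentially"
      using eventually_ge_at_top[of 1]
    proof eventually_elim
      case (elim n)
      then show ?case using log_char_error[of "p n" n t] assms(1) by auto
    qed
    ultimately have "(\<lambda>n. ?E t n - of_real (- (t^2) / 2)) \<longlonglongrightarrow> 0"
      by (rule Lim_null_comparison[rotated])
    then have "(\<lambda>n. ?E t n) \<longlonglongrightarrow> of_real (- (t^2) / 2)"
      by (rule LIM_zero_cancel)
    then have "(\<lambda>n. exp (?E t n)) \<longlonglongrightarrow> exp (of_real (- (t^2) / 2))"
      by (rule tendsto_exp)
    moreover have "eventually (\<lambda>n. exp (?E t n) = char (D n) t) sequentially"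
      using eventually_ge_at_top[of 1] by eventually_elim (simp add: D_def char)
    ultimately have "(\<lambda>n. char (D n) t) \<longlonglongrightarrow> exp (of_real (- (t^2) / 2))"
      by (rule Lim_transform_eventually)
    then show "(\<lambda>n. char (D n) t) \<longlonglongrightarrow> char std_normal_distribution t"
      unfolding exp_of_real char_std_normal_distribution .
  qed
  moreover have "eventually (\<lambda>n. cdf (D n) x = cdf (?D n) x) sequentially" for x
    using eventually_ge_at_top[of 1] by eventually_elim (simp add: D_def)
  ultimately show ?thesis
    unfolding weak_conv_m_def weak_conv_def by (blast intro: Lim_transform_eventually)
qed

end
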